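(* Let $n\ge1$ and $N\ge 1$ be integers, let $a<b$ be real numbers, put $h=(b-a)/N$, and let $f:[a,b]\to\mathbb{R}$ be such that $f^{(n-1)}$ is absolutely continuous. Then for each constant $c$, $$\int_a^b f(x)\,dx = \left(\frac{b-a}{2N}\right)\big(f(a)+f(b)\big)+\left(\frac{b-a}{N}\right)\sum_{k=1}^{N-1} f(a+kh)+\sum_{k=2}^{n}\frac{B_k}{k!}\left(\frac{b-a}{N}\right)^{k}\big(f^{(k-1)}(a)-f^{(k-1)}(b)\big)$$ $$\qquad+c(b-a)^n\big(f^{(n-1)}(a)+f^{(n-1)}(b)\big)+E_{(a,b)}^N\!\left(\frac{B_n(x)}{n!}+c,\,f\right).$$
   Context: The Bernoulli polynomials $B_n(x)$ are defined by $B_0(x)=1$ and, for $n\ge1$, $\frac{d}{dx}B_n(x)=nB_{n-1}(x)$ together with $\int_0^1 B_n(x)\,dx=0$; the Bernoulli numbers are $B_n=B_n(0)$. For a polynomial $p$ of degree $n$ with leading coefficient $1/n!$, an interval $[\alpha,\beta]$ and $f$ with $f^{(n-1)}$ absolutely continuous on $[\alpha,\beta]$, the error term is $$E_{(\alpha,\beta)}(p,f)=(-1)^n(\beta-\alpha)^{n+1}\int_0^1 p(x)f^{(n)}\big(\alpha+(\beta-\alpha)x\big)\,dx.$$ For an integer $N\ge1$ and $h=(b-a)/N$, the composite error term is $$E_{(a,b)}^N(p,f)=\sum_{k=0}^{N-1}E_{(a+kh,\,a+(k+1)h)}(p,f).$$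
   Formalization: The printed term c(b-a)^n(f^(n-1)(a)+f^(n-1)(b)) makes the identity false (n=N=1, [a,b]=[0,1], f=1, c=1 gives 1=3); it is replaced by (-1)^n c((b-a)/N)^n(f^(n-1)(a)-f^(n-1)(b)). *)

theory Defs
  imports "HOL-Analysis.Analysis" "HOL-Computational_Algebra.Polynomial"
begin

primrec bernpoly :: "nat \<Rightarrow> real poly" where
  "bernpoly 0 = 1"
| "bernpoly (Suc n) = (THE p. pderiv p = smult (real (Suc n)) (bernpoly n)
                              \<and> integral {0..1} (poly p) = 0)"

definition bernoulli :: "nat \<Rightarrow> real" where
  "bernoulli n = poly (bernpoly n) 0"

lemma bernpoly_ex1: "\<exists>!p::real poly. pderiv p = r \<and> integral {0..1} (poly p) = 0"
proof -
  have sum_pderiv: "pderiv (sum g A) = (\<Sum>i\<in>A. pderiv (g i))"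
    for g :: "nat \<Rightarrow> real poly" and A
    by (induction A rule: infinite_finite_induct) (simp_all add: pderiv_add)
  define q where "q = (\<Sum>i\<le>degree r. monom (coeff r i / real (Suc i)) (Suc i))"
  have "pderiv q = (\<Sum>i\<le>degree r. monom (coeff r i) i)"
    unfolding q_def sum_pderiv by (intro sum.cong refl) (simp add: pderiv_monom del: of_nat_Suc)
  then have q: "pderiv q = r"
    by (simp add: poly_as_sum_of_monoms)
  have int: "poly p integrable_on {0..1}" for p :: "real poly"
    by (intro integrable_continuous_real continuous_intros)
  have int_add: "integral {0..1} (poly (p + [:c:])) = integral {0..1} (poly p) + c"
    for p :: "real poly" and c
  proof -
    have "poly (p + [:c:]) = (\<lambda>x. poly p x + poly [:c:] x)" and "poly [:c:] = (\<lambda>x. c)"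
      by (simp_all add: fun_eq_iff)
    with integral_add[OF int[of p] int[of "[:c:]"]] show ?thesis by simp
  qed
  show ?thesis
  proof (rule ex1I)
    show "pderiv (q + [:- integral {0..1} (poly q):]) = r
        \<and> integral {0..1} (poly (q + [:- integral {0..1} (poly q):])) = 0"
      using q by (simp only: int_add pderiv_add) (simp add: pderiv_pCons)
  next
    fix p assume p: "pderiv p = r \<and> integral {0..1} (poly p) = 0"
    then have "pderiv (p - q) = 0"
      using q by (simp add: pderiv_diff)
    then obtain c where "p - q = [:c:]"
      by (metis degree_eq_zeroE pderiv_eq_0_iff)
    then have pc: "p = q + [:c:]"
      by (metis add.commute diff_add_cancel)
    with p int_add[of q c] have "c = - integral {0..1} (poly q)"
      by simp
    with pc show "p = q + [:- integral {0..1} (poly q):]"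
      by simp
  qed
qed

lemma bernpoly_Suc:
  shows pderiv_bernpoly_Suc: "pderiv (bernpoly (Suc n)) = smult (real (Suc n)) (bernpoly n)"
    and integral_bernpoly_Suc: "integral {0..1} (poly (bernpoly (Suc n))) = 0"
  using theI'[OF bernpoly_ex1, of "smult (real (Suc n)) (bernpoly n)"] by simp_all

lemma degree_bernpoly: "degree (bernpoly n) = n"
  and lead_coeff_bernpoly: "lead_coeff (bernpoly n) = 1"
proof -
  have "degree (bernpoly n) = n \<and> lead_coeff (bernpoly n) = 1"
  proof (induction n)
    case (Suc n)
    have d: "degree (bernpoly (Suc n)) - 1 = n"
      using degree_pderiv[of "bernpoly (Suc n)"] Suc by (simp add: pderiv_bernpoly_Suc del: bernpoly.simps)
    have "bernpoly n \<noteq> 0" using Suc by auto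
    then have "pderiv (bernpoly (Suc n)) \<noteq> 0"
      by (simp add: pderiv_bernpoly_Suc del: bernpoly.simps of_nat_Suc)
    then have "degree (bernpoly (Suc n)) \<noteq> 0"
      by (simp add: pderiv_eq_0_iff)
    with d have deg: "degree (bernpoly (Suc n)) = Suc n" by simp
    have "coeff (pderiv (bernpoly (Suc n))) n = real (Suc n) * coeff (bernpoly (Suc n)) (Suc n)"
      by (rule coeff_pderiv)
    then have "coeff (bernpoly (Suc n)) (Suc n) = 1"
      using Suc by (auto simp: pderiv_bernpoly_Suc simp del: bernpoly.simps of_nat_Suc)
    with deg show ?case by (simp del: bernpoly.simps)
  qed simp
  then show "degree (bernpoly n) = n" and "lead_coeff (bernpoly n) = 1" by auto
qed

(* Derivatives are taken within S, hence one-sided at the endpoints of an interval, so that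
   only the values of f on S matter.  Where a derivative does not exist the value is
   unspecified; for the top derivative this happens on a null set only. *)
primrec nth_deriv_on :: "nat \<Rightarrow> real set \<Rightarrow> (real \<Rightarrow> real) \<Rightarrow> real \<Rightarrow> real" where
  "nth_deriv_on 0 S f = f"
| "nth_deriv_on (Suc k) S f = (\<lambda>x. vector_derivative (nth_deriv_on k S f) (at x within S))"

(* The members of a division are finitely many nonoverlapping compact intervals. *)
definition absolutely_continuous_on :: "real set \<Rightarrow> (real \<Rightarrow> real) \<Rightarrow> bool" where
  "absolutely_continuous_on S f \<longleftrightarrow>
     (\<forall>e>0. \<exists>d>0. \<forall>D T. D division_of T \<and> T \<subseteq> S \<and> (\<Sum>K\<in>D. measure lborel K) < d
        \<longrightarrow> (\<Sum>K\<in>D. \<bar>f (Sup K) - f (Inf K)\<bar>) < e)"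

definition has_abs_cont_deriv_on :: "nat \<Rightarrow> real set \<Rightarrow> (real \<Rightarrow> real) \<Rightarrow> bool" where
  "has_abs_cont_deriv_on m S f \<longleftrightarrow>
     (\<forall>k<m. \<forall>x\<in>S. nth_deriv_on k S f differentiable (at x within S))
     \<and> absolutely_continuous_on S (nth_deriv_on m S f)"

(* Meant for polynomials p with leading coefficient 1 / fact (degree p). *)
definition quad_error :: "real \<Rightarrow> real \<Rightarrow> real poly \<Rightarrow> (real \<Rightarrow> real) \<Rightarrow> real" where
  "quad_error \<alpha> \<beta> p f = (-1) ^ degree p * (\<beta> - \<alpha>) ^ (degree p + 1) *
     integral {0..1} (\<lambda>x. poly p x * nth_deriv_on (degree p) {\<alpha>..\<beta>} f (\<alpha> + (\<beta> - \<alpha>) * x))"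

definition composite_quad_error ::
    "nat \<Rightarrow> real \<Rightarrow> real \<Rightarrow> real poly \<Rightarrow> (real \<Rightarrow> real) \<Rightarrow> real" where
  "composite_quad_error N a b p f =
     (let h = (b - a) / real N
      in \<Sum>k<N. quad_error (a + real k * h) (a + real (k + 1) * h) p f)"

(* A constant c in the kernel contributes (-1)^n c h^n (f^(n-1)(b) - f^(n-1)(a)), h = (b - a) / N,
   to the composite error.  The term compensating it in the quadrature formula is therefore
   (-1)^n c h^n (f^(n-1)(a) - f^(n-1)(b)).  The source prints c (b - a)^n (f^(n-1)(a) + f^(n-1)(b))
   instead, which is a misprint: with it the formula fails for n = N = 1, f = 1 and any c ~= 0. *)
lemma bernoulli_kernel:
  assumes "n \<ge> 1"
  shows degree_bernoulli_kernel: "degree (smult (1 / fact n) (bernpoly n) + [:c:]) = n"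
    and lead_coeff_bernoulli_kernel:
      "lead_coeff (smult (1 / fact n) (bernpoly n) + [:c:]) = 1 / fact n"
proof -
  have d: "degree (smult (1 / fact n) (bernpoly n)) = n"
    by (simp add: degree_bernpoly)
  show deg: "degree (smult (1 / fact n) (bernpoly n) + [:c:]) = n"
    using d assms by (subst degree_add_eq_left) auto
  have "coeff (bernpoly n) n = 1"
    using lead_coeff_bernpoly[of n] by (simp add: degree_bernpoly)
  then show "lead_coeff (smult (1 / fact n) (bernpoly n) + [:c:]) = 1 / fact n"
    using assms by (simp add: deg coeff_pCons split: nat.split)
qed

end

(* The top derivative of f need not exist everywhere, so its absolute continuity must first be
   turned into something integrable.  A function of bounded variation is differentiable almost
   everywhere: where it is not, its difference quotients are unbounded or oscillate across two
   rationals, and the Vitali covering theorem makes each of these sets null.  Absolute continuity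
   then gives the fundamental theorem of calculus and integration by parts.

   On one subinterval, n successive integrations by parts against the kernels B_k / k! reduce the
   error term to the integral of f; the boundary terms are identified by B_k(1 - x) = (-1)^k B_k(x)
   and by B_k(1) = B_k(0) for k >= 2.  Adding up over the subintervals, the terms in the
   derivatives telescope. *)
theory Submission
  imports Defs
begin

text \<open>The covering estimate needs a monotone function, which \<open>g\<close> need not be. For
  unbounded slopes the total variation \<open>V\<close> takes its place. For oscillating slopes
  \<open>V\<close> alone gives no small bound, since the slopes may stay moderate. There
  \<open>V - g\<close> or \<open>V + g\<close>, chosen separately on each member of a nearly optimal
  division, rises little over the member but steeply wherever \<open>g\<close> runs against its
  increment over that member. Tilting \<open>g\<close> by a linear function turns an oscillation
  across two rationals into one about slope 0.

  The derivative of order n in the error term is taken within each subinterval and may differ at an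
  inner node from the one within \<open>{a..b}\<close>. Only orders up to n - 1 are compared between
  the two, and these agree.

  The trapezoidal weights stem from the first integration by parts, as the linear kernel takes the
  values -1/2 and 1/2 at the ends. Every later Bernoulli kernel takes the same value at both ends,
  so that its boundary term is a difference, as telescoping requires.\<close>

section \<open>Increments over divisions of an interval\<close>

lemma division_of_realD:
  fixes K :: "real set"
  assumes "D division_of T" "K \<in> D"
  shows "Inf K \<le> Sup K" and "K = {Inf K..Sup K}" and "K \<subseteq> T"
proof -
  obtain u v where "K = {u..v}" "u \<le> v"
    using division_ofD(3,4)[OF assms] by (auto simp: box_real)
  then show "Inf K \<le> Sup K" and "K = {Inf K..Sup K}" by auto
  show "K \<subseteq> T" using division_ofD(2)[OF assms] .
qed

lemma sum_division_real:
  fixes h :: "real \<Rightarrow> real"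
  assumes "a \<le> b" and D: "D division_of {a..b}"
  shows "(\<Sum>K\<in>D. h (Sup K) - h (Inf K)) = h b - h a"
proof -
  \<comment> \<open>The telescoping lemma speaks of tagged divisions; the left endpoint is an
    arbitrary choice of tag.\<close>
  let ?t = "\<lambda>K::real set. (Inf K, K)"
  note d = division_ofD[OF D]
  have "(?t ` D) tagged_division_of {a..b}"
  proof (rule tagged_division_ofI)
    show "finite (?t ` D)" using d(1) by simp
    show "x \<in> K" "K \<subseteq> {a..b}" "\<exists>a b. K = cbox a b" if "(x, K) \<in> ?t ` D" for x K
    proof -
      have K: "K \<in> D" "x = Inf K" using that by auto
      note r = division_of_realD[OF D K(1)]
      show "x \<in> K" using r(1,2) K(2) by (metis atLeastAtMost_iff order_refl)
      show "K \<subseteq> {a..b}" by (rule r(3))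
      show "\<exists>a b. K = cbox a b" using r(2) by (metis box_real(2))
    qed
    show "\<Union> {K. \<exists>x. (x, K) \<in> ?t ` D} = {a..b}"
    proof -
      have "{K. \<exists>x. (x, K) \<in> ?t ` D} = D" by auto
      then show ?thesis using d(6) by simp
    qed
  qed (use d(5) in auto)
  from additive_tagged_division_1[OF \<open>a \<le> b\<close> this, of h]
  show ?thesis by (simp add: sum.reindex inj_on_def)
qed

text \<open>Extending \<open>D\<close> to a division of the whole interval only adds nonnegative
  increments, and the extended sum telescopes.\<close>

lemma sum_division_mono_on_le:
  fixes h :: "real \<Rightarrow> real"
  assumes h: "mono_on {a..b} h" and "a \<le> b" and D: "D division_of T" "T \<subseteq> {a..b}"
  shows "(\<Sum>K\<in>D. h (Sup K) - h (Inf K)) \<le> h b - h a"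
proof -
  have "D division_of \<Union>D" "\<Union>D \<subseteq> cbox a b"
    using D by (auto simp: box_real)
  then obtain q where q: "D \<subseteq> q" "q division_of {a..b}"
    by (metis partial_division_extend_interval box_real(2))
  have "(\<Sum>K\<in>D. h (Sup K) - h (Inf K)) \<le> (\<Sum>K\<in>q. h (Sup K) - h (Inf K))"
  proof (rule sum_mono2)
    show "finite q" using q(2) by blast
    show "0 \<le> h (Sup K) - h (Inf K)" if "K \<in> q - D" for K
    proof -
      have K: "K \<in> q" using that by simp
      note r = division_of_realD[OF q(2) K]
      have "Inf K \<in> {a..b}" "Sup K \<in> {a..b}" using r by (metis atLeastAtMost_iff order_refl subsetD)+
      then show ?thesis using mono_onD[OF h] r(1) by simp
    qed
  qed (use q in auto)
  then show ?thesis
    using sum_division_real[OF \<open>a \<le> b\<close> q(2)] by simp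
qed

section \<open>A covering estimate for steep monotone functions\<close>

text \<open>Disjoint steep intervals cover \<open>S\<close> up to a null set. Steepness bounds their
  total length by their total increment of \<open>h\<close> divided by \<open>M\<close>, and
  monotonicity bounds that increment. As \<open>S\<close> is not known to be measurable, the bound
  is put on a measurable superset.\<close>

lemma Vitali_measure_le:
  fixes h :: "real \<Rightarrow> real"
  assumes h: "mono_on {\<alpha>..\<beta>} h" and "\<alpha> \<le> \<beta>" "0 < M"
    and S: "\<And>x d. x \<in> S \<Longrightarrow> 0 < d \<Longrightarrow> \<exists>u v. \<alpha> \<le> u \<and> u < v \<and> v \<le> \<beta> \<and> u \<le> x \<and> x \<le> v \<and> v - u < d
              \<and> M * (v - u) \<le> h v - h u"
  shows "\<exists>T. S \<subseteq> T \<and> T \<in> lmeasurable \<and> measure lebesgue T \<le> (h \<beta> - h \<alpha>) / M"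
proof -
  define Q where "Q = {(u, v). \<alpha> \<le> u \<and> u < v \<and> v \<le> \<beta> \<and> M * (v - u) \<le> h v - h u}"
  \<comment> \<open>Intervals are indexed by their endpoints; midpoint and half length present them
    as the balls that the covering theorem expects.\<close>
  define m r where "m = (\<lambda>(u, v). (u + v) / 2 :: real)" and "r = (\<lambda>(u, v). (v - u) / 2 :: real)"
  have cb: "cball (m i) (r i) = {fst i..snd i}" for i
    by (cases i) (auto simp: m_def r_def cball_eq_atLeastAtMost field_simps)
  obtain C where C: "countable C" "C \<subseteq> Q"
    and disj: "pairwise (\<lambda>i j. disjnt (cball (m i) (r i)) (cball (m j) (r j))) C"
    and neg: "negligible (S - (\<Union>i\<in>C. cball (m i) (r i)))"
  proof (rule Vitali_covering_theorem_cballs[of Q r S m])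
    show "0 < r i" if "i \<in> Q" for i using that by (auto simp: Q_def r_def)
    show "\<exists>i. i \<in> Q \<and> x \<in> cball (m i) (r i) \<and> r i < d" if xd: "x \<in> S" "0 < d" for x d
    proof -
      obtain u v where "\<alpha> \<le> u" "u < v" "v \<le> \<beta>" "u \<le> x" "x \<le> v" "v - u < d" "M * (v - u) \<le> h v - h u"
        using S[OF xd] by blast
      then show ?thesis
        unfolding cb by (intro exI[of _ "(u, v)"]) (auto simp: Q_def r_def)
    qed
  qed
  let ?I = "\<lambda>i::real \<times> real. {fst i..snd i}"
  \<comment> \<open>A bound that is uniform over finite subfamilies passes to the countable
    union.\<close>
  have fin: "measure lebesgue (\<Union>i\<in>F. ?I i) \<le> (h \<beta> - h \<alpha>) / M" if F: "F \<subseteq> C" "finite F" for F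
  proof -
    have FQ: "\<alpha> \<le> fst i" "fst i < snd i" "snd i \<le> \<beta>" "M * (snd i - fst i) \<le> h (snd i) - h (fst i)"
      if "i \<in> F" for i using that F C(2) by (auto simp: Q_def)
    have dj: "?I i \<inter> ?I j = {}" if "i \<in> F" "j \<in> F" "i \<noteq> j" for i j
      using disj that F by (auto simp: pairwise_def disjnt_def cb)
    have inj: "inj_on ?I F"
      by (rule inj_onI) (metis FQ(2) Int_absorb atLeastatMost_empty_iff2 dj less_le_not_le linorder_not_le)
    have D: "(?I ` F) division_of (\<Union>i\<in>F. ?I i)"
    proof (rule division_ofI)
      show "\<And>K. K \<in> ?I ` F \<Longrightarrow> K \<noteq> {}" using FQ(2) by (fastforce)
      show "\<exists>a b. K = cbox a b" if "K \<in> ?I ` F" for K using that by (auto simp: box_real)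
      show "interior K1 \<inter> interior K2 = {}" if "K1 \<in> ?I ` F" "K2 \<in> ?I ` F" "K1 \<noteq> K2" for K1 K2
      proof -
        obtain i j where "i \<in> F" "j \<in> F" "K1 = ?I i" "K2 = ?I j" using \<open>K1 \<in> _\<close> \<open>K2 \<in> _\<close> by blast
        then have "K1 \<inter> K2 = {}" using dj[of i j] \<open>K1 \<noteq> K2\<close> by auto
        then show ?thesis using interior_subset[of K1] interior_subset[of K2] by blast
      qed
    qed (use F in auto)
    have "measure lebesgue (\<Union>i\<in>F. ?I i) \<le> (\<Sum>i\<in>F. measure lebesgue (?I i))"
      by (rule measure_UNION_le) (use F in auto)
    also have "\<dots> = (\<Sum>i\<in>F. snd i - fst i)"
      using FQ(2) by (intro sum.cong) (auto simp: less_imp_le)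
    also have "\<dots> \<le> (\<Sum>i\<in>F. (h (snd i) - h (fst i)) / M)"
      using FQ(4) \<open>0 < M\<close> by (intro sum_mono) (auto simp: field_simps)
    also have "\<dots> = (\<Sum>K\<in>?I ` F. h (Sup K) - h (Inf K)) / M"
      using FQ(2) by (subst sum.reindex[OF inj]) (auto simp: sum_divide_distrib less_imp_le intro!: sum.cong)
    also have "\<dots> \<le> (h \<beta> - h \<alpha>) / M"
    proof (intro divide_right_mono sum_division_mono_on_le[OF h \<open>\<alpha> \<le> \<beta>\<close> D])
      show "(\<Union>i\<in>F. ?I i) \<subseteq> {\<alpha>..\<beta>}" using FQ(1,3) by fastforce
    qed (use \<open>0 < M\<close> in auto)
    finally show ?thesis .
  qed
  let ?U = "\<Union>i\<in>C. ?I i"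
  have U: "?U \<in> lmeasurable" "measure lebesgue ?U \<le> (h \<beta> - h \<alpha>) / M"
    using fmeasurable_UN_bound[OF C(1), of ?I lebesgue] measure_UN_bound[OF C(1), of ?I lebesgue] fin by auto
  have neg': "negligible (S - ?U)" using neg by (simp add: cb)
  have "?U \<union> (S - ?U) \<in> lmeasurable"
    by (rule fmeasurable.Un[OF U(1) negligible_imp_measurable[OF neg']])
  moreover have "measure lebesgue (?U \<union> (S - ?U)) \<le> (h \<beta> - h \<alpha>) / M"
    using measure_Un_le[of ?U lebesgue "S - ?U"] U neg'
    by (smt (verit) fmeasurableD negligible_imp_measurable negligible_imp_measure0)
  ultimately show ?thesis by (intro exI[of _ "?U \<union> (S - ?U)"]) auto
qed

section \<open>Differentiability almost everywhere for bounded variation\<close>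

definition bounded_variation_on :: "real set \<Rightarrow> (real \<Rightarrow> real) \<Rightarrow> bool" where
  "bounded_variation_on S f \<longleftrightarrow>
     (\<exists>B. \<forall>D T. D division_of T \<and> T \<subseteq> S \<longrightarrow> (\<Sum>K\<in>D. \<bar>f (Sup K) - f (Inf K)\<bar>) \<le> B)"

text \<open>The witness is the total variation of \<open>g\<close> on \<open>{a..x}\<close>. Its
  domination of increments also makes it monotone; the near-optimal divisions are what the study of
  oscillating slopes relies on.\<close>

lemma bounded_variation_function:
  fixes g :: "real \<Rightarrow> real"
  assumes "a \<le> b" and bv: "bounded_variation_on {a..b} g"
  shows "\<exists>V. (\<forall>u v. a \<le> u \<longrightarrow> u \<le> v \<longrightarrow> v \<le> b \<longrightarrow> \<bar>g v - g u\<bar> \<le> V v - V u) \<and>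
    (\<forall>e>0. \<exists>D. D division_of {a..b} \<and> V b - V a - e < (\<Sum>K\<in>D. \<bar>g (Sup K) - g (Inf K)\<bar>))"
proof -
  obtain B where B: "\<And>D T. D division_of T \<Longrightarrow> T \<subseteq> {a..b} \<Longrightarrow> (\<Sum>K\<in>D. \<bar>g (Sup K) - g (Inf K)\<bar>) \<le> B"
    using bv unfolding bounded_variation_on_def by blast
  define var where "var D = (\<Sum>K\<in>D. \<bar>g (Sup K) - g (Inf K)\<bar>)" for D
  define W where "W x = {var D | D T. D division_of T \<and> T \<subseteq> {a..x}}" for x
  define V where "V x = Sup (W x)" for x
  have bdd: "bdd_above (W x)" if "x \<le> b" for x
  proof (rule bdd_aboveI[of _ B])
    show "w \<le> B" if "w \<in> W x" for w
    proof -
      obtain D T where "w = var D" "D division_of T" "T \<subseteq> {a..x}"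
        using \<open>w \<in> W x\<close> unfolding W_def by blast
      moreover from this have "T \<subseteq> {a..b}" using \<open>x \<le> b\<close> by fastforce
      ultimately show ?thesis using B[of D T] by (simp add: var_def)
    qed
  qed
  have zero: "0 \<in> W x" for x
    unfolding W_def by (rule CollectI, rule exI[of _ "{}"], rule exI[of _ "{}"]) (auto simp: var_def)
  show ?thesis
  proof (intro exI[of _ V] conjI allI impI)
    fix u v assume uv: "a \<le> u" "u \<le> v" "v \<le> b"
    have "V u \<le> V v - \<bar>g v - g u\<bar>"
      unfolding V_def
    proof (rule cSup_least)
      show "W u \<noteq> {}" using zero by blast
      fix w assume "w \<in> W u"
      then obtain D T where D: "D division_of T" "T \<subseteq> {a..u}" and w: "w = var D"
        by (auto simp: W_def)
      show "w \<le> Sup (W v) - \<bar>g v - g u\<bar>"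
      \<comment> \<open>For \<open>u < v\<close>, adjoining \<open>{u..v}\<close> to a division
        inside \<open>{a..u}\<close> gives a competitor for \<open>W v\<close>. A degenerate
        \<open>{u..v}\<close> could already belong to \<open>D\<close>, hence the case
        split.\<close>
      proof (cases "u < v")
        case True
        have uvd: "{{u..v}} division_of {u..v}"
          using division_of_self[of u v] uv by (simp add: box_real)
        have "interior T \<subseteq> {a<..<u}"
          using interior_mono[OF D(2)] by simp
        then have "(D \<union> {{u..v}}) division_of (T \<union> {u..v})"
          by (intro division_disjoint_union D(1) uvd) auto
        moreover have "T \<union> {u..v} \<subseteq> {a..v}" using D(2) uv by auto
        ultimately have "var (D \<union> {{u..v}}) \<in> W v" unfolding W_def by blast
        moreover have "{u..v} \<notin> D"
        proof
          assume "{u..v} \<in> D"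
          then have "{u..v} \<subseteq> {a..u}" using division_ofD(2)[OF D(1)] D(2) by blast
          then show False using True uv by auto
        qed
        then have "var (D \<union> {{u..v}}) = var D + \<bar>g v - g u\<bar>"
          using division_ofD(1)[OF D(1)] uv by (simp add: var_def)
        ultimately show ?thesis
          using cSup_upper[OF _ bdd[OF uv(3)]] w by fastforce
      next
        case False
        then have "u = v" using uv by simp
        then show ?thesis
          using cSup_upper[OF \<open>w \<in> W u\<close>] bdd uv by auto
      qed
    qed
    then show "\<bar>g v - g u\<bar> \<le> V v - V u" by simp
  next
    fix e :: real assume "0 < e"
    have "0 \<le> V a" unfolding V_def by (rule cSup_upper[OF zero bdd]) (use \<open>a \<le> b\<close> in auto)
    then have "V b - V a - e < Sup (W b)" using \<open>0 < e\<close> by (simp add: V_def)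
    then obtain w where "w \<in> W b" and w: "V b - V a - e < w"
      using less_cSupD[of "W b"] zero by blast
    then obtain D T where D: "D division_of T" "T \<subseteq> {a..b}" "w = var D"
      by (auto simp: W_def)
    have "D division_of \<Union>D" "\<Union>D \<subseteq> cbox a b"
      \<comment> \<open>Passing to a division of all of \<open>{a..b}\<close> can only increase the
        sum.\<close>
      using D by (auto simp: box_real)
    then obtain q where q: "D \<subseteq> q" "q division_of {a..b}"
      by (metis partial_division_extend_interval box_real(2))
    have "var D \<le> var q"
      unfolding var_def by (rule sum_mono2) (use q in auto)
    then show "\<exists>D. D division_of {a..b} \<and> V b - V a - e < (\<Sum>K\<in>D. \<bar>g (Sup K) - g (Inf K)\<bar>)"
      using q w D(3) by (auto simp: var_def)
  qed
qed

text \<open>Steep chords of \<open>g\<close> are steep chords of its variation \<open>V\<close>.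
  They occur at every scale and for every bound \<open>M\<close>, so the outer measure is at most
  the total variation divided by an arbitrary \<open>M\<close>.\<close>

lemma negligible_unbounded_slope:
  fixes g :: "real \<Rightarrow> real"
  assumes "a \<le> b" and bv: "bounded_variation_on {a..b} g"
  shows "negligible {x \<in> {a..b}. \<forall>M. \<exists>\<^sub>F y in at x within {a..b}. M < \<bar>(g y - g x) / (y - x)\<bar>}"
    (is "negligible ?S")
proof -
  obtain V where V: "\<And>u v. a \<le> u \<Longrightarrow> u \<le> v \<Longrightarrow> v \<le> b \<Longrightarrow> \<bar>g v - g u\<bar> \<le> V v - V u"
    using bounded_variation_function[OF assms] by metis
  have mono: "mono_on {a..b} V"
  proof (rule mono_onI)
    fix x y assume "x \<in> {a..b}" "y \<in> {a..b}" "x \<le> y"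
    then show "V x \<le> V y" using V[of x y] by simp
  qed
  show ?thesis
    unfolding negligible_outer_le
  proof (intro allI impI)
    fix e :: real assume "0 < e"
    \<comment> \<open>Chosen so that the total variation divided by \<open>M\<close> is at most
      \<open>e\<close>; the summand 1 keeps \<open>M\<close> positive when the variation
      vanishes.\<close>
    define M where "M = (V b - V a + 1) / e"
    have VV: "V b - V a \<ge> 0" using V[of a b] \<open>a \<le> b\<close> by simp
    then have "0 < M" using \<open>0 < e\<close> by (simp add: M_def)
    have "\<exists>T. ?S \<subseteq> T \<and> T \<in> lmeasurable \<and> measure lebesgue T \<le> (V b - V a) / M"
    proof (rule Vitali_measure_le[OF mono \<open>a \<le> b\<close> \<open>0 < M\<close>])
      fix x d assume x: "x \<in> ?S" and "(0::real) < d"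
      have xab: "a \<le> x" "x \<le> b" and "\<exists>\<^sub>F y in at x within {a..b}. M < \<bar>(g y - g x) / (y - x)\<bar>"
        using x by auto
      then obtain y where y: "y \<in> {a..b}" "y \<noteq> x" "dist y x < d" "M < \<bar>(g y - g x) / (y - x)\<bar>"
        unfolding frequently_at using \<open>0 < d\<close> by blast
      have *: "M * \<bar>y - x\<bar> \<le> \<bar>g y - g x\<bar>"
        using y(2,4) by (simp add: abs_divide field_simps)
      show "\<exists>u v. a \<le> u \<and> u < v \<and> v \<le> b \<and> u \<le> x \<and> x \<le> v \<and> v - u < d \<and> M * (v - u) \<le> V v - V u"
      proof (cases "x < y")
        case True
        then show ?thesis using y * xab V[of x y] by (intro exI[of _ x] exI[of _ y]) (auto simp: dist_real_def)
      next
        case False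
        then show ?thesis using y * xab V[of y x] by (intro exI[of _ y] exI[of _ x]) (auto simp: dist_real_def)
      qed
    qed
    moreover have "(V b - V a) / M \<le> e"
      using VV \<open>0 < e\<close> by (simp add: M_def field_simps)
    ultimately show "\<exists>T. ?S \<subseteq> T \<and> T \<in> lmeasurable \<and> measure lebesgue T \<le> e"
      by (meson order_trans)
  qed
qed

text \<open>On a member \<open>K\<close> of a division whose sum nearly attains the total variation, the increment
  of \<open>g\<close> nearly exhausts the variation of \<open>g\<close>; this leaves little room for intervals on which
  \<open>g\<close> has a steep slope of the opposite sign.\<close>

lemma negligible_oscillating_slope:
  fixes g :: "real \<Rightarrow> real"
  assumes "a \<le> b" and bv: "bounded_variation_on {a..b} g" and "0 < M"
  shows "negligible {x \<in> {a..b}. (\<exists>\<^sub>F y in at x within {a..b}. M < (g y - g x) / (y - x)) \<and>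
            (\<exists>\<^sub>F y in at x within {a..b}. (g y - g x) / (y - x) < - M)}"
    (is "negligible ?S")
proof -
  obtain V where V': "\<forall>u v. a \<le> u \<longrightarrow> u \<le> v \<longrightarrow> v \<le> b \<longrightarrow> \<bar>g v - g u\<bar> \<le> V v - V u"
    and VD': "\<forall>e>0. \<exists>D. D division_of {a..b} \<and> V b - V a - e < (\<Sum>K\<in>D. \<bar>g (Sup K) - g (Inf K)\<bar>)"
    using bounded_variation_function[OF \<open>a \<le> b\<close> bv] by blast
  note V = V'[rule_format] and VD = VD'[rule_format]
  show ?thesis
    unfolding negligible_outer_le
  proof (intro allI impI)
    fix e :: real assume "0 < e"
    then have "0 < e * (2 * M)" using \<open>0 < M\<close> by simp
    from VD[OF this] obtain D where D: "D division_of {a..b}"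
      and VDe: "V b - V a - e * (2 * M) < (\<Sum>K\<in>D. \<bar>g (Sup K) - g (Inf K)\<bar>)"
      by blast
    \<comment> \<open>The numerator is the variation on \<open>K\<close> that the increment of
      \<open>g\<close> leaves over; the divisor \<open>2 * M\<close> anticipates the slope of
      \<open>h\<close> below.\<close>
    define def where "def K = ((V (Sup K) - V (Inf K)) - \<bar>g (Sup K) - g (Inf K)\<bar>) / (2 * M)" for K
    have "\<exists>T. ?S \<inter> {Inf K<..<Sup K} \<subseteq> T \<and> T \<in> lmeasurable \<and> measure lebesgue T \<le> def K" if K: "K \<in> D" for K
    proof -
      define u v where "u = Inf K" and "v = Sup K"
      have uv: "u \<le> v" "{u..v} \<subseteq> {a..b}"
        using division_of_realD[OF D K] by (auto simp: u_def v_def)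
      then have uv': "a \<le> u" "v \<le> b" by auto
      \<comment> \<open>The sign orients \<open>g\<close> so that \<open>s * g\<close> does not
        decrease from \<open>u\<close> to \<open>v\<close>. Then \<open>h\<close> is monotone, as
        \<open>V\<close> dominates the increments, and its rise over \<open>K\<close> is exactly the
        left-over variation.\<close>
      define s :: real where "s = (if g u \<le> g v then 1 else - 1)"
      define h where "h x = V x - s * g x" for x
      have s: "s * g v - s * g u = \<bar>g v - g u\<bar>" "\<bar>s * z\<bar> = \<bar>z\<bar>" for z
        by (auto simp: s_def)
      have Vs: "\<bar>s * g q - s * g p\<bar> \<le> V q - V p" if "u \<le> p" "p \<le> q" "q \<le> v" for p q
        using V[of p q] s(2)[of "g q - g p"] that uv' by (simp add: algebra_simps)
      have "mono_on {u..v} h"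
      proof (rule mono_onI)
        fix p q assume "p \<in> {u..v}" "q \<in> {u..v}" "p \<le> q"
        then show "h p \<le> h q" using Vs[of p q] by (simp add: h_def)
      qed
      moreover have "0 < 2 * M" using \<open>0 < M\<close> by simp
      moreover have "\<exists>p q. u \<le> p \<and> p < q \<and> q \<le> v \<and> p \<le> x \<and> x \<le> q \<and> q - p < d \<and> 2 * M * (q - p) \<le> h q - h p"
        if x: "x \<in> ?S \<inter> {u<..<v}" and "0 < d" for x d
      proof -
        \<comment> \<open>The radius also keeps \<open>y\<close> inside \<open>{u..v}\<close>, where
          \<open>h\<close> is known to be monotone.\<close>
        let ?d = "min d (min (x - u) (v - x))"
        have d: "0 < ?d" using x \<open>0 < d\<close> by auto
        \<comment> \<open>Slopes of both signs occur near \<open>x\<close>; for either value of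
          \<open>s\<close> one of the two kinds runs against the orientation.\<close>
        have "\<exists>\<^sub>F y in at x within {a..b}. s * ((g y - g x) / (y - x)) < - M"
        proof (cases "g u \<le> g v")
          case True then show ?thesis using x by (simp add: s_def)
        next
          case False
          have "\<exists>\<^sub>F y in at x within {a..b}. M < (g y - g x) / (y - x)" using x by simp
          moreover have "s * z = - z" for z using False by (simp add: s_def)
          ultimately show ?thesis by (simp only: neg_less_iff_less)
        qed
        then obtain y where y: "y \<in> {a..b}" "y \<noteq> x" "dist y x < ?d" "s * ((g y - g x) / (y - x)) < - M"
          unfolding frequently_at using d by blast
        define p q where "p = min x y" and "q = max x y"
        have pq: "p < q" "u \<le> p" "q \<le> v" "q - p < d" "p \<le> x" "x \<le> q"
          using y(2,3) x by (auto simp: p_def q_def dist_real_def min_def max_def split: if_splits)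
        have "(g q - g p) / (q - p) = (g y - g x) / (y - x)"
          using minus_divide_divide[of "g y - g x" "y - x"] by (auto simp: p_def q_def min_def max_def)
        with y(4) have "s * ((g q - g p) / (q - p)) < - M" by simp
        then have "s * g q - s * g p < - M * (q - p)"
          using pq(1) by (simp add: field_simps)
        \<comment> \<open>Here \<open>- s * g\<close> rises by more than \<open>M * (q - p)\<close>,
          and \<open>V\<close> rises at least as much, whence the factor 2.\<close>
        then have "2 * M * (q - p) \<le> h q - h p"
          using Vs[of p q] pq by (simp add: h_def abs_if split: if_splits)
        then show ?thesis using pq by blast
      qed
      ultimately have "\<exists>T. ?S \<inter> {u<..<v} \<subseteq> T \<and> T \<in> lmeasurable \<and> measure lebesgue T \<le> (h v - h u) / (2 * M)"
        by (intro Vitali_measure_le uv(1))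
      moreover have "(h v - h u) / (2 * M) = def K"
        using s(1) by (simp add: h_def def_def u_def v_def)
      ultimately show ?thesis by (simp add: u_def v_def)
    qed
    then have "\<forall>K\<in>D. \<exists>T. ?S \<inter> {Inf K<..<Sup K} \<subseteq> T \<and> T \<in> lmeasurable \<and> measure lebesgue T \<le> def K" ..
    then obtain T where T': "\<forall>K\<in>D. ?S \<inter> {Inf K<..<Sup K} \<subseteq> T K \<and> T K \<in> lmeasurable \<and> measure lebesgue (T K) \<le> def K"
      unfolding bchoice_iff by (elim exE) rule
    then have T: "?S \<inter> {Inf K<..<Sup K} \<subseteq> T K" "T K \<in> lmeasurable" "measure lebesgue (T K) \<le> def K"
      if "K \<in> D" for K using that by simp_all
    \<comment> \<open>Endpoints of members escape the estimate, which needs chords on both sides of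
      \<open>x\<close> to stay in \<open>K\<close>; they are finitely many.\<close>
    let ?E = "Inf ` D \<union> Sup ` D" and ?T = "\<Union>K\<in>D. T K"
    have finD: "finite D" using D by blast
    have nE: "negligible ?E" using finD by (intro negligible_finite) auto
    have meas: "?T \<in> lmeasurable" using T(2) finD by (intro fmeasurable.finite_UN) auto
    have "measure lebesgue ?T \<le> (\<Sum>K\<in>D. measure lebesgue (T K))"
      by (rule measure_UNION_le[OF finD]) (use T(2) in auto)
    also have "\<dots> \<le> (\<Sum>K\<in>D. def K)" by (rule sum_mono) (use T(3) in auto)
    also have "\<dots> = ((\<Sum>K\<in>D. V (Sup K) - V (Inf K)) - (\<Sum>K\<in>D. \<bar>g (Sup K) - g (Inf K)\<bar>)) / (2 * M)"
      by (simp add: def_def sum_divide_distrib[symmetric] sum_subtractf)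
    \<comment> \<open>The increments of \<open>V\<close> telescope, so the numerator is the total
      variation minus the division sum, which is less than \<open>e * (2 * M)\<close> by the choice
      of \<open>D\<close>.\<close>
    also have "\<dots> \<le> e"
      using VDe \<open>0 < M\<close> by (simp add: sum_division_real[OF \<open>a \<le> b\<close> D] field_simps)
    finally have mT: "measure lebesgue ?T \<le> e" .
    have "?S \<subseteq> ?T \<union> ?E"
    proof
      fix x assume x: "x \<in> ?S"
      then have "x \<in> \<Union>D" using division_ofD(6)[OF D] by auto
      then obtain K where K: "K \<in> D" "x \<in> K" by blast
      then have "x \<in> {Inf K..Sup K}" using division_of_realD(2)[OF D K(1)] by metis
      then consider "x = Inf K" | "x = Sup K" | "x \<in> ?S \<inter> {Inf K<..<Sup K}" using x by force
      then show "x \<in> ?T \<union> ?E"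
      proof cases
        case 3
        then have "x \<in> T K" using T(1)[OF K(1)] by (rule rev_subsetD)
        then show ?thesis using K(1) by blast
      qed (use K(1) in blast)+
    qed
    moreover have "?T \<union> ?E \<in> lmeasurable"
      by (rule fmeasurable.Un[OF meas negligible_imp_measurable[OF nE]])
    moreover have "measure lebesgue (?T \<union> ?E) \<le> e"
      using measure_Un_le[of ?T lebesgue ?E] meas mT nE
      by (smt (verit) fmeasurableD negligible_imp_measurable negligible_imp_measure0)
    ultimately show "\<exists>T. ?S \<subseteq> T \<and> T \<in> lmeasurable \<and> measure lebesgue T \<le> e" by blast
  qed
qed

lemma sum_length_division_le:
  fixes a b :: real
  assumes "a \<le> b" "D division_of T" "T \<subseteq> {a..b}"
  shows "(\<Sum>K\<in>D. Sup K - Inf K) \<le> b - a"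
  by (rule sum_division_mono_on_le[of a b "\<lambda>x. x", OF _ assms]) (simp add: mono_on_def)

text \<open>Subtracting \<open>m * x\<close> shifts all slopes by \<open>m\<close>, so that
  oscillation about \<open>m\<close> reduces to oscillation about 0.\<close>

lemma bounded_variation_on_diff_linear:
  assumes "a \<le> b" and "bounded_variation_on {a..b} g"
  shows "bounded_variation_on {a..b} (\<lambda>x. g x - m * x)"
proof -
  obtain B where B: "\<And>D T. D division_of T \<Longrightarrow> T \<subseteq> {a..b} \<Longrightarrow> (\<Sum>K\<in>D. \<bar>g (Sup K) - g (Inf K)\<bar>) \<le> B"
    using assms unfolding bounded_variation_on_def by blast
  show ?thesis
    unfolding bounded_variation_on_def
  proof (intro exI allI impI, elim conjE)
    fix D T assume D: "D division_of T" "T \<subseteq> {a..b}"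
    have "(\<Sum>K\<in>D. \<bar>(g (Sup K) - m * Sup K) - (g (Inf K) - m * Inf K)\<bar>)
        \<le> (\<Sum>K\<in>D. \<bar>g (Sup K) - g (Inf K)\<bar> + \<bar>m\<bar> * (Sup K - Inf K))"
    proof (rule sum_mono)
      fix K assume "K \<in> D"
      then have "Inf K \<le> Sup K" using division_of_realD[OF D(1)] by blast
      then have "\<bar>m * Sup K - m * Inf K\<bar> = \<bar>m\<bar> * (Sup K - Inf K)"
        by (simp add: abs_mult right_diff_distrib[symmetric])
      then show "\<bar>(g (Sup K) - m * Sup K) - (g (Inf K) - m * Inf K)\<bar>
          \<le> \<bar>g (Sup K) - g (Inf K)\<bar> + \<bar>m\<bar> * (Sup K - Inf K)" by linarith
    qed
    also have "\<dots> \<le> B + \<bar>m\<bar> * (b - a)"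
      using B[OF D] sum_length_division_le[OF \<open>a \<le> b\<close> D]
      by (simp add: sum.distrib sum_distrib_left[symmetric] add_mono mult_left_mono)
    finally show "(\<Sum>K\<in>D. \<bar>(g (Sup K) - m * Sup K) - (g (Inf K) - m * Inf K)\<bar>) \<le> B + \<bar>m\<bar> * (b - a)" .
  qed
qed

lemma bounded_variation_on_differentiable_ae:
  fixes g :: "real \<Rightarrow> real"
  assumes bv: "bounded_variation_on {a..b} g"
  shows "negligible {x \<in> {a..b}. \<not> g differentiable (at x within {a..b})}"
    (is "negligible ?N")
proof (cases "a < b")
  case False
  then have "?N \<subseteq> {a}" by auto
  then show ?thesis by (rule negligible_subset[OF negligible_sing])
next
  case ab: True
  define E where "E = {x \<in> {a..b}. \<forall>M. \<exists>\<^sub>F y in at x within {a..b}. M < \<bar>(g y - g x) / (y - x)\<bar>}"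
  \<comment> \<open>At these points the slopes of \<open>g\<close> are frequently above
    \<open>m + M\<close> and frequently below \<open>m - M\<close>. Rational parameters suffice and
    keep the union countable.\<close>
  define Osc where "Osc m M = {x \<in> {a..b}.
      (\<exists>\<^sub>F y in at x within {a..b}. M < ((g y - m * y) - (g x - m * x)) / (y - x)) \<and>
      (\<exists>\<^sub>F y in at x within {a..b}. ((g y - m * y) - (g x - m * x)) / (y - x) < - M)}" for m M :: real
  have "negligible E"
    unfolding E_def using ab by (intro negligible_unbounded_slope bv) simp
  moreover have "negligible (Osc m M)" if "0 < M" for m M
    unfolding Osc_def using ab that
    by (intro negligible_oscillating_slope bounded_variation_on_diff_linear bv) auto
  then have "negligible (\<Union>((\<lambda>(m, M). Osc m M) ` ({(m, M). 0 < M} \<inter> \<rat> \<times> \<rat>)))"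
    by (intro negligible_countable_Union countable_image countable_Int2 countable_SIGMA countable_rat) auto
  ultimately have "negligible (E \<union> \<Union>((\<lambda>(m, M). Osc m M) ` ({(m, M). 0 < M} \<inter> \<rat> \<times> \<rat>)))"
    by (rule negligible_Un)
  moreover have "?N \<subseteq> E \<union> \<Union>((\<lambda>(m, M). Osc m M) ` ({(m, M). 0 < M} \<inter> \<rat> \<times> \<rat>))"
  proof
    fix x assume x: "x \<in> ?N"
    let ?F = "at x within {a..b}"
    let ?q = "\<lambda>y. (g y - g x) / (y - x)"
    have nb: "?F \<noteq> bot" using x ab by (simp add: trivial_limit_within islimpt_Icc)
    show "x \<in> E \<union> \<Union>((\<lambda>(m, M). Osc m M) ` ({(m, M). 0 < M} \<inter> \<rat> \<times> \<rat>))"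
    proof (cases "Liminf ?F (\<lambda>y. ereal (?q y)) < Limsup ?F (\<lambda>y. ereal (?q y))")
      case True
      then obtain s where s: "Liminf ?F (\<lambda>y. ereal (?q y)) < ereal (of_rat s)" "ereal (of_rat s) < Limsup ?F (\<lambda>y. ereal (?q y))"
        using ereal_dense3 by blast
      then obtain t where t: "ereal (of_rat s) < ereal (of_rat t)" "ereal (of_rat t) < Limsup ?F (\<lambda>y. ereal (?q y))"
        using ereal_dense3 by blast
      \<comment> \<open>Midpoint and half the gap of two rationals strictly between the lower and
        the upper limit of the slopes.\<close>
      define m M :: real where "m = of_rat ((s + t) / 2)" and "M = of_rat ((t - s) / 2)"
      have st: "of_rat s = m - M" "of_rat t = m + M"
        by (simp_all add: m_def M_def of_rat_add of_rat_diff of_rat_divide field_simps)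
      have "0 < M" using t(1) st by simp
      have lo: "\<exists>\<^sub>F y in ?F. ?q y < m - M"
      proof (rule ccontr)
        assume "\<not> ?thesis"
        then have "ereal (m - M) \<le> Liminf ?F (\<lambda>y. ereal (?q y))"
          by (intro Liminf_bounded) (simp add: not_frequently not_less)
        then show False using s(1) st by simp
      qed
      have hi: "\<exists>\<^sub>F y in ?F. m + M < ?q y"
      proof (rule ccontr)
        assume "\<not> ?thesis"
        then have "Limsup ?F (\<lambda>y. ereal (?q y)) \<le> ereal (m + M)"
          by (intro Limsup_bounded) (simp add: not_frequently not_less)
        then show False using t(2) st by simp
      qed
      have q: "((g y - m * y) - (g x - m * x)) / (y - x) = ?q y - m" if "y \<noteq> x" for y
        using that by (simp add: field_simps)
      have ev: "\<forall>\<^sub>F y in ?F. y \<noteq> x" by (simp add: eventually_at_filter)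
      have "x \<in> Osc m M"
        unfolding Osc_def
      proof (intro CollectI conjI)
        show "x \<in> {a..b}" using x by simp
        show "\<exists>\<^sub>F y in ?F. M < ((g y - m * y) - (g x - m * x)) / (y - x)"
          by (rule frequently_rev_mp[OF hi], rule eventually_mono[OF ev]) (simp add: q)
        show "\<exists>\<^sub>F y in ?F. ((g y - m * y) - (g x - m * x)) / (y - x) < - M"
          by (rule frequently_rev_mp[OF lo], rule eventually_mono[OF ev]) (simp add: q)
      qed
      moreover have "(m, M) \<in> {(m, M). 0 < M} \<inter> \<rat> \<times> \<rat>"
        using \<open>0 < M\<close> by (simp add: m_def M_def)
      ultimately show ?thesis by blast
    next
      case False
      define L where "L = Limsup ?F (\<lambda>y. ereal (?q y))"
      have LL: "Liminf ?F (\<lambda>y. ereal (?q y)) = L"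
        using False Liminf_le_Limsup[OF nb] unfolding L_def by (meson antisym not_less)
      then have lim: "((\<lambda>y. ereal (?q y)) \<longlongrightarrow> L) ?F"
        by (simp add: tendsto_iff_Liminf_eq_Limsup[OF nb] L_def)
      \<comment> \<open>The limit of the slopes exists but may be infinite. If \<open>x\<close> were
        outside \<open>E\<close>, the slopes would be bounded near \<open>x\<close>, hence the limit
        finite and \<open>g\<close> differentiable at \<open>x\<close>.\<close>
      have "x \<in> E"
      proof (rule ccontr)
        assume "x \<notin> E"
        then obtain M where M: "\<forall>\<^sub>F y in ?F. \<bar>?q y\<bar> \<le> M"
          using x by (auto simp: E_def not_frequently not_less)
        have "L \<le> ereal M"
          by (rule tendsto_upperbound[OF lim _ nb]) (rule eventually_mono[OF M], auto simp: abs_le_iff simp del: abs_divide)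
        moreover have "ereal (- M) \<le> L"
          by (rule tendsto_lowerbound[OF lim _ nb]) (rule eventually_mono[OF M], auto simp: abs_le_iff simp del: abs_divide)
        ultimately obtain c where "L = ereal c"
          by (cases L) auto
        with lim have "(g has_field_derivative c) ?F"
          by (simp add: has_field_derivative_iff)
        then have "g differentiable ?F"
          by (auto simp: has_field_derivative_def differentiable_def)
        then show False using x by simp
      qed
      then show ?thesis by blast
    qed
  qed
  ultimately show ?thesis by (rule negligible_subset)
qed

section \<open>Differentiability almost everywhere for absolute continuity\<close>

lemma measure_lborel_division_member:
  fixes K :: "real set"
  assumes "D division_of T" "K \<in> D"
  shows "measure lborel K = Sup K - Inf K"
  using division_of_realD(1,2)[OF assms] by (metis content_real)

lemma absolutely_continuous_onD:
  assumes "absolutely_continuous_on S f" "0 < e"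
  obtains d where "0 < d" "\<And>D T. D division_of T \<Longrightarrow> T \<subseteq> S \<Longrightarrow> (\<Sum>K\<in>D. Sup K - Inf K) < d
        \<Longrightarrow> (\<Sum>K\<in>D. \<bar>f (Sup K) - f (Inf K)\<bar>) < e"
proof -
  obtain d where "0 < d" and d: "\<And>D T. D division_of T \<and> T \<subseteq> S \<and> (\<Sum>K\<in>D. measure lborel K) < d
        \<Longrightarrow> (\<Sum>K\<in>D. \<bar>f (Sup K) - f (Inf K)\<bar>) < e"
    using assms unfolding absolutely_continuous_on_def by blast
  show thesis
  proof (rule that[OF \<open>0 < d\<close>])
    fix D T assume D: "D division_of T" "T \<subseteq> S" "(\<Sum>K\<in>D. Sup K - Inf K) < d"
    then have "(\<Sum>K\<in>D. measure lborel K) < d"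
      by (simp add: measure_lborel_division_member[OF D(1)] cong: sum.cong)
    with D show "(\<Sum>K\<in>D. \<bar>f (Sup K) - f (Inf K)\<bar>) < e" by (intro d) auto
  qed
qed

text \<open>Absolute continuity with e = 1 bounds the variation by 1 on every interval shorter than
  the matching \<open>d\<close>. As negligibility is a local property, bounded variation near each
  point is enough.\<close>

lemma absolutely_continuous_on_differentiable_ae:
  assumes ac: "absolutely_continuous_on {a..b} g"
  shows "negligible {x \<in> {a..b}. \<not> g differentiable (at x within {a..b})}"
    (is "negligible ?N")
  unfolding locally_negligible_alt[of ?N]
proof (intro ballI)
  fix x assume x: "x \<in> ?N"
  obtain d where "0 < d" and d: "\<And>D T. D division_of T \<Longrightarrow> T \<subseteq> {a..b} \<Longrightarrow> (\<Sum>K\<in>D. Sup K - Inf K) < d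
        \<Longrightarrow> (\<Sum>K\<in>D. \<bar>g (Sup K) - g (Inf K)\<bar>) < 1"
    using absolutely_continuous_onD[OF ac zero_less_one] by blast
  define r where "r = d / 3"
  have r: "0 < r" "2 * r < d" using \<open>0 < d\<close> by (simp_all add: r_def)
  define u v where "u = max a (x - r)" and "v = min b (x + r)"
  have uv: "u \<le> v" "v - u < d" "{u..v} = {a..b} \<inter> {x - r..x + r}"
    using x r by (auto simp: u_def v_def)
  have "bounded_variation_on {u..v} g"
    unfolding bounded_variation_on_def
  proof (intro exI allI impI, elim conjE)
    fix D T assume D: "D division_of T" "T \<subseteq> {u..v}"
    have "(\<Sum>K\<in>D. Sup K - Inf K) < d"
      using sum_length_division_le[OF uv(1) D] uv(2) by simp
    moreover have "T \<subseteq> {a..b}" using D(2) uv(3) by auto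
    ultimately show "(\<Sum>K\<in>D. \<bar>g (Sup K) - g (Inf K)\<bar>) \<le> 1"
      using d[OF D(1)] by fastforce
  qed
  then have "negligible {y \<in> {u..v}. \<not> g differentiable (at y within {u..v})}"
    by (rule bounded_variation_on_differentiable_ae)
  moreover have "?N \<inter> ball x (r) \<subseteq> {y \<in> {u..v}. \<not> g differentiable (at y within {u..v})}"
  proof
    fix y assume y: "y \<in> ?N \<inter> ball x (r)"
    \<comment> \<open>Inside the open ball both intervals coincide, so the cut ends of
      \<open>{u..v}\<close> do not affect the derivative.\<close>
    have "at y within {a..b} = at y within {u..v}"
    proof (rule at_within_nhd)
      show "y \<in> ball x (r)" using y by simp
      show "{a..b} \<inter> ball x (r) - {y} = {u..v} \<inter> ball x (r) - {y}"
        by (auto simp: uv(3) dist_real_def)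
    qed simp
    moreover have "y \<in> {u..v}" using y by (auto simp: uv(3) dist_real_def)
    ultimately show "y \<in> {y \<in> {u..v}. \<not> g differentiable (at y within {u..v})}"
      using y by simp
  qed
  ultimately have "negligible (?N \<inter> ball x (r))" by (rule negligible_subset)
  moreover have "openin (top_of_set ?N) (?N \<inter> ball x (r))"
    by (rule openin_open_Int) simp
  moreover have "x \<in> ?N \<inter> ball x (r)" using x r by simp
  ultimately show "\<exists>U. openin (top_of_set ?N) U \<and> x \<in> U \<and> negligible U"
    by blast
qed

section \<open>The fundamental theorem of calculus\<close>

text \<open>Distinct members meet at most in endpoints, so their lengths add up to the measure of
  \<open>T\<close>.\<close>

lemma sum_length_division_le_measure:
  fixes T :: "real set"
  assumes D: "D division_of T" and "T \<subseteq> U" "U \<in> lmeasurable"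
  shows "(\<Sum>K\<in>D. Sup K - Inf K) \<le> measure lebesgue U"
proof -
  have lm: "K \<in> lmeasurable" "measure lebesgue K = Sup K - Inf K" if "K \<in> D" for K
  proof -
    have "{Inf K..Sup K} \<in> lmeasurable" "measure lebesgue {Inf K..Sup K} = Sup K - Inf K"
      using division_of_realD(1)[OF D that] by simp_all
    then show "K \<in> lmeasurable" "measure lebesgue K = Sup K - Inf K"
      using division_of_realD(2)[OF D that] by metis+
  qed
  have neg: "negligible (K \<inter> L)" if "K \<in> D" "L \<in> D" "K \<noteq> L" for K L
  proof -
    have "K \<inter> L \<subseteq> {Inf K, Sup K, Inf L, Sup L}"
    proof
      fix x assume x: "x \<in> K \<inter> L"
      have K: "K = {Inf K..Sup K}" and L: "L = {Inf L..Sup L}"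
        using division_of_realD(2)[OF D] that by blast+
      have iK: "{Inf K<..<Sup K} \<subseteq> interior K" by (subst (3) K) simp
      have iL: "{Inf L<..<Sup L} \<subseteq> interior L" by (subst (3) L) simp
      have "x \<in> {Inf K..Sup K}" "x \<in> {Inf L..Sup L}" using x K L by auto
      moreover have "\<not> (x \<in> {Inf K<..<Sup K} \<and> x \<in> {Inf L<..<Sup L})"
        using iK iL division_ofD(5)[OF D that] by blast
      ultimately show "x \<in> {Inf K, Sup K, Inf L, Sup L}" by auto
    qed
    then show ?thesis by (rule negligible_subset[rotated]) (intro negligible_finite, simp)
  qed
  have fin: "finite D" using D by blast
  have "(\<Sum>K\<in>D. Sup K - Inf K) = (\<Sum>K\<in>D. measure lebesgue K)"
    using lm(2) by (intro sum.cong) simp_all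
  also have "\<dots> = measure lebesgue (\<Union>D)"
    by (rule measure_negligible_finite_Union[symmetric, OF fin]) (use lm neg in \<open>auto simp: pairwise_def\<close>)
  also have "\<Union>D = T" using D by (rule division_ofD(6))
  also have "measure lebesgue T \<le> measure lebesgue U"
  proof (rule measure_mono_fmeasurable[OF assms(2) _ assms(3)])
    have "\<Union>D \<in> lmeasurable" using fin lm(1) by (intro fmeasurable.finite_Union) auto
    then show "T \<in> sets lebesgue" using division_ofD(6)[OF D] by auto
  qed
  finally show ?thesis .
qed

lemma negligible_outer_open:
  fixes N :: "real set"
  assumes "negligible N" "0 < d"
  obtains U where "open U" "N \<subseteq> U" "U \<in> lmeasurable" "measure lebesgue U < d"
proof -
  have N: "N \<in> lmeasurable" "measure lebesgue N = 0"
    using assms(1) by (auto simp: negligible_imp_measurable negligible_imp_measure0)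
  obtain U where U: "open U" "N \<subseteq> U" "U - N \<in> lmeasurable" "emeasure lebesgue (U - N) < ennreal d"
    using sets_lebesgue_outer_open[OF fmeasurableD[OF N(1)] assms(2)] by blast
  have "N \<union> (U - N) \<in> lmeasurable" by (rule fmeasurable.Un[OF N(1) U(3)])
  moreover have "N \<union> (U - N) = U" using U(2) by auto
  moreover have "measure lebesgue (N \<union> (U - N)) \<le> measure lebesgue N + measure lebesgue (U - N)"
    using N(1) U(3) by (intro measure_Un_le) auto
  moreover have "measure lebesgue (U - N) < d"
    using U(3,4) assms(2) by (simp add: emeasure_eq_measure2 ennreal_less_iff)
  ultimately show thesis using that U(1,2) N(2) by simp
qed

text \<open>Henstock's integral makes this direct: tags in the exceptional null set are confined to an
  open set of small measure, where absolute continuity controls the increments of \<open>g\<close>.\<close>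

theorem fundamental_theorem_of_calculus_absolutely_continuous:
  fixes g :: "real \<Rightarrow> real"
  assumes "a \<le> b" and ac: "absolutely_continuous_on {a..b} g" and N: "negligible N"
    and g': "\<And>x. x \<in> {a..b} - N \<Longrightarrow> (g has_vector_derivative g' x) (at x within {a..b})"
  shows "(g' has_integral (g b - g a)) {a..b}"
proof (rule has_integral_spike[OF N])
  \<comment> \<open>Nothing is known of \<open>g'\<close> on \<open>N\<close>. With the value 0
    there, a tag in \<open>N\<close> contributes only the increment of \<open>g\<close>.\<close>
  let ?f = "\<lambda>x. if x \<in> N then 0 else g' x"
  show "\<And>x. x \<in> {a..b} - N \<Longrightarrow> g' x = ?f x" by simp
  have "(?f has_integral (g b - g a)) (cbox a b)"
    unfolding has_integral
  proof (intro allI impI)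
    fix e :: real assume "0 < e"
    \<comment> \<open>The summand 1 avoids division by zero for \<open>a = b\<close> and makes the
      bound \<open>e / 2\<close> strict.\<close>
    define e1 where "e1 = e / (2 * (b - a + 1))"
    have e1: "0 < e1" "e1 * (b - a) < e / 2"
      using \<open>0 < e\<close> \<open>a \<le> b\<close> by (auto simp: e1_def field_simps)
    have "0 < e / 2" using \<open>0 < e\<close> by simp
    from absolutely_continuous_onD[OF ac this]
    obtain d where "0 < d" and d: "\<And>D T. D division_of T \<Longrightarrow> T \<subseteq> {a..b} \<Longrightarrow> (\<Sum>K\<in>D. Sup K - Inf K) < d
        \<Longrightarrow> (\<Sum>K\<in>D. \<bar>g (Sup K) - g (Inf K)\<bar>) < e / 2" by blast
    obtain U where U: "open U" "N \<subseteq> U" "U \<in> lmeasurable" "measure lebesgue U < d"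
      using negligible_outer_open[OF N \<open>0 < d\<close>] by blast
    have "\<exists>r>0. (x \<in> N \<longrightarrow> ball x r \<subseteq> U) \<and>
        (x \<in> {a..b} - N \<longrightarrow> (\<forall>y\<in>{a..b}. \<bar>y - x\<bar> < r \<longrightarrow> \<bar>g y - g x - (y - x) * g' x\<bar> \<le> e1 * \<bar>y - x\<bar>))" for x
    proof (cases "x \<in> N")
      case True
      then show ?thesis using U(1,2) openE by blast
    next
      case False
      show ?thesis
      proof (cases "x \<in> {a..b}")
        case True
        then have "(g has_vector_derivative g' x) (at x within {a..b})" using False g' by blast
        then show ?thesis
          using False e1(1) unfolding has_vector_derivative_def has_derivative_within_alt by fastforce
      qed (use False in \<open>auto intro: exI[of _ 1]\<close>)
    qed
    then obtain r where r0: "\<And>x. 0 < r x"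
      and rN: "\<And>x. x \<in> N \<Longrightarrow> ball x (r x) \<subseteq> U"
      and rD: "\<And>x y. x \<in> {a..b} - N \<Longrightarrow> y \<in> {a..b} \<Longrightarrow> \<bar>y - x\<bar> < r x \<Longrightarrow> \<bar>g y - g x - (y - x) * g' x\<bar> \<le> e1 * \<bar>y - x\<bar>"
      by metis
    define \<gamma> where "\<gamma> x = ball x (r x)" for x
    have g1: "gauge \<gamma>" using r0 by (auto simp: \<gamma>_def gauge_def)
    have g2: "norm ((\<Sum>(x,K)\<in>p. measure lborel K *\<^sub>R ?f x) - (g b - g a)) < e"
      if p: "p tagged_division_of cbox a b" and fine: "\<gamma> fine p" for p
    proof -
      note pD = tagged_division_ofD[OF p]
      have K: "Inf K \<le> Sup K" "K = {Inf K..Sup K}" "x \<in> K" "K \<subseteq> {a..b}" "K \<subseteq> ball x (r x)" if "(x, K) \<in> p" for x K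
      proof -
        have "snd (x, K) \<in> snd ` p" using that by (rule imageI)
        then have "K \<in> snd ` p" by simp
        from division_of_realD[OF division_of_tagged_division[OF p] this]
        show "Inf K \<le> Sup K" "K = {Inf K..Sup K}" "K \<subseteq> {a..b}" by (simp_all add: box_real)
        show "x \<in> K" using pD(2) that by blast
        show "K \<subseteq> ball x (r x)" using fine that by (auto simp: fine_def \<gamma>_def)
      qed
      let ?g = "\<lambda>K::real set. g (Sup K) - g (Inf K)"
      define p1 p2 where "p1 = {t \<in> p. fst t \<in> N}" and "p2 = {t \<in> p. fst t \<notin> N}"
      have p12: "p = p1 \<union> p2" "p1 \<inter> p2 = {}" "finite p1" "finite p2"
        using pD(1) by (auto simp: p1_def p2_def)
      have p1p: "p1 tagged_partial_division_of cbox a b"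
        by (rule tagged_partial_division_subset[of p]) (use p in \<open>auto simp: p1_def tagged_division_of_def\<close>)
      let ?T = "\<Union>(snd ` p1)"
      have D1: "snd ` p1 division_of ?T" by (rule partial_division_of_tagged_division[OF p1p])
      have TU: "?T \<subseteq> U"
        using K(5) rN by (fastforce simp: p1_def)
      have Tab: "?T \<subseteq> {a..b}" using K(4) by (fastforce simp: p1_def)
      have ne: "K \<noteq> {}" if "(x, K) \<in> p1" for x K
        using K(3)[of x K] that by (auto simp: p1_def)
      \<comment> \<open>Dropping the tags from the sum requires a summand that vanishes on every box
        with empty interior, including the empty set, where \<open>Sup\<close> and
        \<open>Inf\<close> are unspecified.\<close>
      have "(\<Sum>(x,K)\<in>p1. \<bar>?g K\<bar>) = (\<Sum>(x,K)\<in>p1. if K = {} then 0 else \<bar>?g K\<bar>)"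
        by (intro sum.cong) (auto dest: ne)
      also have "\<dots> = (\<Sum>K\<in>snd ` p1. if K = {} then 0 else \<bar>?g K\<bar>)"
        by (rule sum.over_tagged_division_lemma[OF tagged_partial_division_of_Union_self[OF p1p]])
          (auto simp: box_eq_empty not_less le_less)
      also have "\<dots> = (\<Sum>K\<in>snd ` p1. \<bar>?g K\<bar>)"
        using division_ofD(3)[OF D1] by (intro sum.cong) auto
      also have "\<dots> < e / 2"
        by (rule d[OF D1 Tab]) (use sum_length_division_le_measure[OF D1 TU U(3)] U(4) in simp)
      finally have s1: "(\<Sum>(x,K)\<in>p1. \<bar>?g K\<bar>) < e / 2" .
      have s2: "(\<Sum>(x,K)\<in>p2. \<bar>measure lborel K *\<^sub>R ?f x - ?g K\<bar>) \<le> e1 * (b - a)"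
      proof -
        have "(\<Sum>(x,K)\<in>p2. \<bar>measure lborel K *\<^sub>R ?f x - ?g K\<bar>) \<le> (\<Sum>(x,K)\<in>p2. e1 * (Sup K - Inf K))"
        proof (rule sum_mono, safe)
          fix x K assume "(x, K) \<in> p2"
          then have xK: "(x, K) \<in> p" "x \<notin> N" by (auto simp: p2_def)
          define u v where "u = Inf K" and "v = Sup K"
          have uv: "u \<le> v" "K = {u..v}" "u \<le> x" "x \<le> v"
            using K(1-3)[OF xK(1)] by (auto simp: u_def v_def)
          then have "u \<in> K" "v \<in> K" "x \<in> K" by auto
          then have "u \<in> {a..b}" "v \<in> {a..b}" "x \<in> {a..b}" "\<bar>u - x\<bar> < r x" "\<bar>v - x\<bar> < r x"
            using K(4,5)[OF xK(1)] by (auto simp: dist_real_def subset_eq abs_minus_commute)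
          then have "\<bar>g u - g x - (u - x) * g' x\<bar> \<le> e1 * (x - u)" "\<bar>g v - g x - (v - x) * g' x\<bar> \<le> e1 * (v - x)"
            using rD[of x u] rD[of x v] xK(2) uv by auto
          \<comment> \<open>Splitting at the tag: as \<open>x\<close> lies between \<open>u\<close>
            and \<open>v\<close>, the two linearization errors are bounded by \<open>e1\<close>
            times lengths that add up to the length of \<open>K\<close>.\<close>
          moreover have "measure lborel K *\<^sub>R ?f x - ?g K = (g u - g x - (u - x) * g' x) - (g v - g x - (v - x) * g' x)"
            using uv(1) xK(2) by (subst uv(2)) (simp add: u_def[symmetric] v_def[symmetric] algebra_simps)
          moreover have "e1 * (Sup K - Inf K) = e1 * (x - u) + e1 * (v - x)"
            by (simp add: u_def v_def algebra_simps)
          ultimately show "\<bar>measure lborel K *\<^sub>R ?f x - ?g K\<bar> \<le> e1 * (Sup K - Inf K)" by linarith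
        qed
        also have "\<dots> \<le> (\<Sum>(x,K)\<in>p. e1 * (Sup K - Inf K))"
          by (rule sum_mono2) (use pD(1) K(1) e1(1) in \<open>auto simp: p2_def\<close>)
        also have "\<dots> = e1 * (\<Sum>(x,K)\<in>p. Sup K - Inf K)"
          by (simp add: sum_distrib_left split_def)
        also have "(\<Sum>(x,K)\<in>p. Sup K - Inf K) = b - a"
          using additive_tagged_division_1[OF \<open>a \<le> b\<close>, of p "\<lambda>x. x"] p by (simp add: box_real)
        finally show ?thesis .
      qed
      have "(\<Sum>(x,K)\<in>p. measure lborel K *\<^sub>R ?f x) - (g b - g a) = (\<Sum>(x,K)\<in>p. measure lborel K *\<^sub>R ?f x - ?g K)"
        using additive_tagged_division_1[OF \<open>a \<le> b\<close>, of p g] p by (simp add: box_real split_def sum_subtractf)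
      then have "norm ((\<Sum>(x,K)\<in>p. measure lborel K *\<^sub>R ?f x) - (g b - g a)) \<le> (\<Sum>(x,K)\<in>p. \<bar>measure lborel K *\<^sub>R ?f x - ?g K\<bar>)"
        by (simp only: real_norm_def) (simp only: split_def sum_abs)
      also have "\<dots> = (\<Sum>(x,K)\<in>p1. \<bar>measure lborel K *\<^sub>R ?f x - ?g K\<bar>) + (\<Sum>(x,K)\<in>p2. \<bar>measure lborel K *\<^sub>R ?f x - ?g K\<bar>)"
        unfolding p12(1) by (rule sum.union_disjoint[OF p12(3,4,2)])
      also have "(\<Sum>(x,K)\<in>p1. \<bar>measure lborel K *\<^sub>R ?f x - ?g K\<bar>) = (\<Sum>(x,K)\<in>p1. \<bar>?g K\<bar>)"
        by (rule sum.cong) (auto simp: p1_def)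
      finally show ?thesis using s1 s2 e1(2) by linarith
    qed
    show "\<exists>\<gamma>. gauge \<gamma> \<and> (\<forall>p. p tagged_division_of cbox a b \<and> \<gamma> fine p \<longrightarrow>
        norm ((\<Sum>(x,K)\<in>p. measure lborel K *\<^sub>R ?f x) - (g b - g a)) < e)"
      by (intro exI[of _ \<gamma>] conjI allI impI g1, elim conjE, rule g2)
  qed
  then show "(?f has_integral (g b - g a)) {a..b}" by (simp add: box_real)
qed

section \<open>Further properties of absolute continuity\<close>

lemma absolutely_continuous_onI:
  assumes "\<And>e. 0 < e \<Longrightarrow> \<exists>d>0. \<forall>D T. D division_of T \<longrightarrow> T \<subseteq> S \<longrightarrow> (\<Sum>K\<in>D. Sup K - Inf K) < d
        \<longrightarrow> (\<Sum>K\<in>D. \<bar>f (Sup K) - f (Inf K)\<bar>) < e"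
  shows "absolutely_continuous_on S f"
  unfolding absolutely_continuous_on_def
proof (intro allI impI)
  fix e :: real assume "0 < e"
  from assms[OF this] obtain d where "0 < d" and d': "\<forall>D T. D division_of T \<longrightarrow> T \<subseteq> S \<longrightarrow> (\<Sum>K\<in>D. Sup K - Inf K) < d
        \<longrightarrow> (\<Sum>K\<in>D. \<bar>f (Sup K) - f (Inf K)\<bar>) < e" by blast
  note d = d'[rule_format]
  show "\<exists>d>0. \<forall>D T. D division_of T \<and> T \<subseteq> S \<and> (\<Sum>K\<in>D. measure lborel K) < d
        \<longrightarrow> (\<Sum>K\<in>D. \<bar>f (Sup K) - f (Inf K)\<bar>) < e"
  proof (intro exI[of _ d] conjI allI impI \<open>0 < d\<close>, elim conjE)
    fix D T assume D: "D division_of T" "T \<subseteq> S" "(\<Sum>K\<in>D. measure lborel K) < d"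
    have "(\<Sum>K\<in>D. Sup K - Inf K) < d"
      using D(3) by (simp add: measure_lborel_division_member[OF D(1)] cong: sum.cong)
    with D show "(\<Sum>K\<in>D. \<bar>f (Sup K) - f (Inf K)\<bar>) < e" by (intro d) auto
  qed
qed

lemma absolutely_continuous_on_subset:
  "absolutely_continuous_on S f \<Longrightarrow> T \<subseteq> S \<Longrightarrow> absolutely_continuous_on T f"
  unfolding absolutely_continuous_on_def by (meson order_trans)

lemma lipschitz_imp_absolutely_continuous_on:
  fixes f :: "real \<Rightarrow> real"
  assumes L: "\<And>x y. x \<in> {a..b} \<Longrightarrow> y \<in> {a..b} \<Longrightarrow> \<bar>f y - f x\<bar> \<le> L * \<bar>y - x\<bar>"
  shows "absolutely_continuous_on {a..b} f"
proof (rule absolutely_continuous_onI)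
  fix e :: real assume "0 < e"
  \<comment> \<open>A positive Lipschitz constant, so that \<open>e / M\<close> makes sense.\<close>
  define M where "M = \<bar>L\<bar> + 1"
  have "0 < M" "L \<le> M" by (auto simp: M_def)
  show "\<exists>d>0. \<forall>D T. D division_of T \<longrightarrow> T \<subseteq> {a..b} \<longrightarrow> (\<Sum>K\<in>D. Sup K - Inf K) < d
        \<longrightarrow> (\<Sum>K\<in>D. \<bar>f (Sup K) - f (Inf K)\<bar>) < e"
  proof (intro exI[of _ "e / M"] conjI allI impI)
    show "0 < e / M" using \<open>0 < e\<close> \<open>0 < M\<close> by simp
    fix D T assume D: "D division_of T" "T \<subseteq> {a..b}" "(\<Sum>K\<in>D. Sup K - Inf K) < e / M"
    have "(\<Sum>K\<in>D. \<bar>f (Sup K) - f (Inf K)\<bar>) \<le> (\<Sum>K\<in>D. M * (Sup K - Inf K))"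
    proof (rule sum_mono)
      fix K assume K: "K \<in> D"
      note k = division_of_realD[OF D(1) K]
      have "Inf K \<in> {a..b}" "Sup K \<in> {a..b}"
        using k D(2) by (metis atLeastAtMost_iff order_refl subsetD)+
      then have "\<bar>f (Sup K) - f (Inf K)\<bar> \<le> L * (Sup K - Inf K)" using L[of "Inf K" "Sup K"] k(1) by simp
      also have "\<dots> \<le> M * (Sup K - Inf K)" using \<open>L \<le> M\<close> k(1) by (intro mult_right_mono) auto
      finally show "\<bar>f (Sup K) - f (Inf K)\<bar> \<le> M * (Sup K - Inf K)" .
    qed
    also have "\<dots> < e"
      using D(3) \<open>0 < M\<close> by (simp add: sum_distrib_left[symmetric] pos_less_divide_eq mult.commute)
    finally show "(\<Sum>K\<in>D. \<bar>f (Sup K) - f (Inf K)\<bar>) < e" .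
  qed
qed

text \<open>Serves both factors in the integration by parts: the polynomial kernel and the
  derivatives of \<open>f\<close> below the top one.\<close>

lemma C1_imp_absolutely_continuous_on:
  fixes f :: "real \<Rightarrow> real"
  assumes f': "\<And>x. x \<in> {a..b} \<Longrightarrow> (f has_vector_derivative f' x) (at x within {a..b})"
    and "continuous_on {a..b} f'"
  shows "absolutely_continuous_on {a..b} f"
proof -
  have "bounded (f' ` {a..b})"
    by (intro compact_imp_bounded compact_continuous_image assms(2)) simp
  then obtain L where L: "\<And>x. x \<in> {a..b} \<Longrightarrow> \<bar>f' x\<bar> \<le> L"
    unfolding bounded_iff by (metis imageI real_norm_def)
  show ?thesis
  proof (rule lipschitz_imp_absolutely_continuous_on)
    fix x y assume "x \<in> {a..b}" "y \<in> {a..b}"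
    then have "norm (f y - f x) \<le> L * norm (y - x)"
    proof (intro field_differentiable_bound[of "{a..b}" f f'])
      show "(f has_field_derivative f' z) (at z within {a..b})" if "z \<in> {a..b}" for z
        using f'[OF that] by (simp add: has_real_derivative_iff_has_vector_derivative)
    qed (use L in auto)
    then show "\<bar>f y - f x\<bar> \<le> L * \<bar>y - x\<bar>" by simp
  qed
qed

lemma absolutely_continuous_on_imp_continuous_on:
  assumes ac: "absolutely_continuous_on {a..b} f"
  shows "continuous_on {a..b} f"
  unfolding continuous_on_iff
proof (intro ballI allI impI)
  fix x e assume x: "x \<in> {a..b}" and "(0::real) < e"
  obtain d where "0 < d" and d: "\<And>D T. D division_of T \<Longrightarrow> T \<subseteq> {a..b} \<Longrightarrow> (\<Sum>K\<in>D. Sup K - Inf K) < d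
        \<Longrightarrow> (\<Sum>K\<in>D. \<bar>f (Sup K) - f (Inf K)\<bar>) < e"
    using absolutely_continuous_onD[OF ac \<open>0 < e\<close>] by blast
  have *: "\<bar>f v - f u\<bar> < e" if "u \<in> {a..b}" "v \<in> {a..b}" "u \<le> v" "v - u < d" for u v
  proof -
    have "{{u..v}} division_of {u..v}" using division_of_self[of u v] that by (simp add: box_real)
    from d[OF this] show ?thesis using that by auto
  qed
  show "\<exists>d>0. \<forall>x'\<in>{a..b}. dist x' x < d \<longrightarrow> dist (f x') (f x) < e"
  proof (intro exI[of _ d] conjI ballI impI \<open>0 < d\<close>)
    fix y assume "y \<in> {a..b}" "dist y x < d"
    then show "dist (f y) (f x) < e"
      using *[of x y] *[of y x] x by (cases "x \<le> y") (auto simp: dist_real_def abs_minus_commute)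
  qed
qed

lemma absolutely_continuous_on_mult:
  assumes f: "absolutely_continuous_on {a..b} f" and g: "absolutely_continuous_on {a..b} g"
  shows "absolutely_continuous_on {a..b} (\<lambda>x. f x * g x)"
proof -
  have bnd: "\<exists>B>0. \<forall>x\<in>{a..b}. \<bar>f x\<bar> \<le> B" if "absolutely_continuous_on {a..b} f" for f
  proof -
    have "bounded (f ` {a..b})"
      by (intro compact_imp_bounded compact_continuous_image absolutely_continuous_on_imp_continuous_on[OF that]) simp
    then show ?thesis unfolding bounded_pos by auto
  qed
  obtain A where A: "0 < A" "\<And>x. x \<in> {a..b} \<Longrightarrow> \<bar>f x\<bar> \<le> A" using bnd[OF f] by blast
  obtain B where B: "0 < B" "\<And>x. x \<in> {a..b} \<Longrightarrow> \<bar>g x\<bar> \<le> B" using bnd[OF g] by blast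
  show ?thesis
  proof (rule absolutely_continuous_onI)
    fix e :: real assume "0 < e"
    have "0 < e / (2 * B)" "0 < e / (2 * A)" using \<open>0 < e\<close> A B by simp_all
    obtain d1 where "0 < d1" and d1: "\<And>D T. D division_of T \<Longrightarrow> T \<subseteq> {a..b} \<Longrightarrow> (\<Sum>K\<in>D. Sup K - Inf K) < d1
        \<Longrightarrow> (\<Sum>K\<in>D. \<bar>f (Sup K) - f (Inf K)\<bar>) < e / (2 * B)"
      using absolutely_continuous_onD[OF f \<open>0 < e / (2 * B)\<close>] by blast
    obtain d2 where "0 < d2" and d2: "\<And>D T. D division_of T \<Longrightarrow> T \<subseteq> {a..b} \<Longrightarrow> (\<Sum>K\<in>D. Sup K - Inf K) < d2
        \<Longrightarrow> (\<Sum>K\<in>D. \<bar>g (Sup K) - g (Inf K)\<bar>) < e / (2 * A)"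
      using absolutely_continuous_onD[OF g \<open>0 < e / (2 * A)\<close>] by blast
    show "\<exists>d>0. \<forall>D T. D division_of T \<longrightarrow> T \<subseteq> {a..b} \<longrightarrow> (\<Sum>K\<in>D. Sup K - Inf K) < d
        \<longrightarrow> (\<Sum>K\<in>D. \<bar>f (Sup K) * g (Sup K) - f (Inf K) * g (Inf K)\<bar>) < e"
    proof (intro exI[of _ "min d1 d2"] conjI allI impI)
      show "0 < min d1 d2" using \<open>0 < d1\<close> \<open>0 < d2\<close> by simp
      fix D T assume D: "D division_of T" "T \<subseteq> {a..b}" "(\<Sum>K\<in>D. Sup K - Inf K) < min d1 d2"
      have "(\<Sum>K\<in>D. \<bar>f (Sup K) * g (Sup K) - f (Inf K) * g (Inf K)\<bar>)
          \<le> (\<Sum>K\<in>D. A * \<bar>g (Sup K) - g (Inf K)\<bar> + B * \<bar>f (Sup K) - f (Inf K)\<bar>)"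
      proof (rule sum_mono)
        fix K assume K: "K \<in> D"
        note k = division_of_realD[OF D(1) K]
        have k': "Inf K \<in> {a..b}" "Sup K \<in> {a..b}"
          using k D(2) by (metis atLeastAtMost_iff order_refl subsetD)+
        have "f (Sup K) * g (Sup K) - f (Inf K) * g (Inf K)
            = f (Sup K) * (g (Sup K) - g (Inf K)) + g (Inf K) * (f (Sup K) - f (Inf K))"
          by (simp add: algebra_simps)
        then have "\<bar>f (Sup K) * g (Sup K) - f (Inf K) * g (Inf K)\<bar>
            \<le> \<bar>f (Sup K)\<bar> * \<bar>g (Sup K) - g (Inf K)\<bar> + \<bar>g (Inf K)\<bar> * \<bar>f (Sup K) - f (Inf K)\<bar>"
          using abs_triangle_ineq by (metis abs_mult)
        also have "\<dots> \<le> A * \<bar>g (Sup K) - g (Inf K)\<bar> + B * \<bar>f (Sup K) - f (Inf K)\<bar>"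
          using A B k' by (intro add_mono mult_right_mono) auto
        finally show "\<bar>f (Sup K) * g (Sup K) - f (Inf K) * g (Inf K)\<bar>
            \<le> A * \<bar>g (Sup K) - g (Inf K)\<bar> + B * \<bar>f (Sup K) - f (Inf K)\<bar>" .
      qed
      also have "\<dots> = A * (\<Sum>K\<in>D. \<bar>g (Sup K) - g (Inf K)\<bar>) + B * (\<Sum>K\<in>D. \<bar>f (Sup K) - f (Inf K)\<bar>)"
        by (simp add: sum.distrib sum_distrib_left)
      also have "\<dots> < A * (e / (2 * A)) + B * (e / (2 * B))"
        using d1[OF D(1,2)] d2[OF D(1,2)] D(3) A B by (intro add_strict_mono mult_strict_left_mono) auto
      also have "\<dots> = e" using A B by (simp add: field_simps)
      finally show "(\<Sum>K\<in>D. \<bar>f (Sup K) * g (Sup K) - f (Inf K) * g (Inf K)\<bar>) < e" .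
    qed
  qed
qed

section \<open>Integration by parts against a polynomial\<close>

text \<open>The fundamental theorem for the product makes the sum of both terms integrable. The term
  without the derivative of \<open>g\<close> is continuous, so subtracting it yields the
  integrability of the other one.\<close>

lemma has_integral_poly_mult_deriv:
  fixes g :: "real \<Rightarrow> real"
  assumes "a < b" and g: "absolutely_continuous_on {a..b} g"
  shows "((\<lambda>x. poly q x * vector_derivative g (at x within {a..b})) has_integral
      (poly q b * g b - poly q a * g a - integral {a..b} (\<lambda>x. poly (pderiv q) x * g x))) {a..b}"
proof -
  have q': "(poly q has_vector_derivative poly (pderiv q) x) (at x within {a..b})" for x
    using poly_DERIV[of q x] by (simp add: has_real_derivative_iff_has_vector_derivative has_vector_derivative_at_within)
  have "absolutely_continuous_on {a..b} (poly q)"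
    using q' by (rule C1_imp_absolutely_continuous_on) (intro continuous_intros)
  then have ac: "absolutely_continuous_on {a..b} (\<lambda>x. poly q x * g x)"
    using g by (rule absolutely_continuous_on_mult)
  let ?g' = "\<lambda>x. vector_derivative g (at x within {a..b})"
  have "((\<lambda>x. poly q x * ?g' x + poly (pderiv q) x * g x) has_integral (poly q b * g b - poly q a * g a)) {a..b}"
  proof (rule fundamental_theorem_of_calculus_absolutely_continuous[OF _ ac absolutely_continuous_on_differentiable_ae[OF g]])
    fix x assume "x \<in> {a..b} - {x \<in> {a..b}. \<not> g differentiable (at x within {a..b})}"
    then have "(g has_vector_derivative ?g' x) (at x within {a..b})"
      by (simp add: vector_derivative_works)
    from has_vector_derivative_mult[OF q' this]
    show "((\<lambda>x. poly q x * g x) has_vector_derivative poly q x * ?g' x + poly (pderiv q) x * g x) (at x within {a..b})" .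
  qed (use \<open>a < b\<close> in simp)
  moreover have "(\<lambda>x. poly (pderiv q) x * g x) integrable_on {a..b}"
    by (intro integrable_continuous_real continuous_intros absolutely_continuous_on_imp_continuous_on[OF g])
  ultimately have "((\<lambda>x. (poly q x * ?g' x + poly (pderiv q) x * g x) - poly (pderiv q) x * g x) has_integral
      (poly q b * g b - poly q a * g a - integral {a..b} (\<lambda>x. poly (pderiv q) x * g x))) {a..b}"
    by (intro has_integral_diff integrable_integral)
  then show ?thesis by simp
qed

lemma has_integral_unit_interval:
  fixes F :: "real \<Rightarrow> real"
  assumes "a < b" and "(F has_integral I) {a..b}"
  shows "((\<lambda>x. F (a + (b - a) * x)) has_integral (I / (b - a))) {0..1}"
  using has_integral_affinity'[of F I a b "b - a" a] assms
  by (simp add: box_real add.commute divide_inverse mult.commute)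

lemma integral_poly_mult_deriv_unit:
  fixes g :: "real \<Rightarrow> real"
  assumes "a < b" and g: "absolutely_continuous_on {a..b} g"
  shows "(b - a) * integral {0..1} (\<lambda>x. poly p x * vector_derivative g (at (a + (b - a) * x) within {a..b}))
    = poly p 1 * g b - poly p 0 * g a - integral {0..1} (\<lambda>x. poly (pderiv p) x * g (a + (b - a) * x))"
proof -
  define h where "h = b - a"
  have "0 < h" using \<open>a < b\<close> by (simp add: h_def)
  \<comment> \<open>The kernel transported from \<open>{0..1}\<close> to \<open>{a..b}\<close>; the
    factor \<open>1 / h\<close> from the chain rule cancels against the substitution in the
    remaining integral.\<close>
  define q where "q = pcompose p [:- a / h, 1 / h:]"
  have q: "poly q (a + h * x) = poly p x" for x
    using \<open>0 < h\<close> by (simp add: q_def poly_pcompose field_simps)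
  have q': "poly (pderiv q) (a + h * x) = poly (pderiv p) x / h" for x
    using \<open>0 < h\<close> by (simp add: q_def pderiv_pcompose poly_pcompose pderiv_pCons field_simps)
  have cont: "(\<lambda>x. poly (pderiv q) x * g x) integrable_on {a..b}"
    by (intro integrable_continuous_real continuous_intros absolutely_continuous_on_imp_continuous_on[OF g])
  define J where "J = integral {a..b} (\<lambda>x. poly (pderiv q) x * g x)"
  have "((\<lambda>x. poly (pderiv q) (a + (b - a) * x) * g (a + (b - a) * x)) has_integral (J / (b - a))) {0..1}"
    unfolding J_def by (rule has_integral_unit_interval[OF \<open>a < b\<close> integrable_integral[OF cont]])
  then have "((\<lambda>x. poly (pderiv p) x / h * g (a + h * x)) has_integral (J / h)) {0..1}"
    by (simp add: h_def[symmetric] q')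
  from has_integral_mult_right[OF this, of h]
  have "((\<lambda>x. poly (pderiv p) x * g (a + h * x)) has_integral J) {0..1}"
    using \<open>0 < h\<close> by simp
  then have J: "integral {0..1} (\<lambda>x. poly (pderiv p) x * g (a + h * x)) = J"
    by (rule integral_unique)
  have "poly q b = poly p 1" "poly q a = poly p 0" using q[of 1] q[of 0] by (simp_all add: h_def)
  then have "((\<lambda>x. poly q x * vector_derivative g (at x within {a..b})) has_integral
      (poly p 1 * g b - poly p 0 * g a - J)) {a..b}"
    using has_integral_poly_mult_deriv[OF assms, of q] by (simp add: J_def)
  from has_integral_unit_interval[OF \<open>a < b\<close> this]
  have "((\<lambda>x. poly p x * vector_derivative g (at (a + h * x) within {a..b})) has_integral
      ((poly p 1 * g b - poly p 0 * g a - J) / h)) {0..1}"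
    by (simp add: h_def[symmetric] q)
  then show ?thesis
    using \<open>0 < h\<close> J by (simp add: integral_unique h_def[symmetric])
qed

section \<open>Derivatives on subintervals\<close>

lemma absolutely_continuous_on_cong:
  assumes "\<And>x. x \<in> S \<Longrightarrow> f x = g x" and ac: "absolutely_continuous_on S f"
  shows "absolutely_continuous_on S g"
proof (rule absolutely_continuous_onI)
  fix e :: real assume "0 < e"
  obtain d where "0 < d" and d: "\<And>D T. D division_of T \<Longrightarrow> T \<subseteq> S \<Longrightarrow> (\<Sum>K\<in>D. Sup K - Inf K) < d
        \<Longrightarrow> (\<Sum>K\<in>D. \<bar>f (Sup K) - f (Inf K)\<bar>) < e"
    using absolutely_continuous_onD[OF ac \<open>0 < e\<close>] by blast
  show "\<exists>d>0. \<forall>D T. D division_of T \<longrightarrow> T \<subseteq> S \<longrightarrow> (\<Sum>K\<in>D. Sup K - Inf K) < d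
        \<longrightarrow> (\<Sum>K\<in>D. \<bar>g (Sup K) - g (Inf K)\<bar>) < e"
  proof (intro exI[of _ d] conjI allI impI \<open>0 < d\<close>)
    fix D T assume D: "D division_of T" "T \<subseteq> S" "(\<Sum>K\<in>D. Sup K - Inf K) < d"
    have "(\<Sum>K\<in>D. \<bar>g (Sup K) - g (Inf K)\<bar>) = (\<Sum>K\<in>D. \<bar>f (Sup K) - f (Inf K)\<bar>)"
    proof (rule sum.cong[OF refl])
      fix K assume K: "K \<in> D"
      have "Inf K \<in> S" "Sup K \<in> S"
        using division_of_realD[OF D(1) K] D(2) by (metis atLeastAtMost_iff order_refl subsetD)+
      then show "\<bar>g (Sup K) - g (Inf K)\<bar> = \<bar>f (Sup K) - f (Inf K)\<bar>" using assms(1) by simp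
    qed
    then show "(\<Sum>K\<in>D. \<bar>g (Sup K) - g (Inf K)\<bar>) < e" using d[OF D] by simp
  qed
qed

text \<open>A derivative within \<open>{a..b}\<close> is also one within the smaller interval, and a
  nondegenerate interval determines it uniquely, even at an endpoint. This reaches order
  \<open>m\<close> because all lower derivatives are differentiable everywhere.\<close>

lemma nth_deriv_on_subinterval:
  assumes "a \<le> \<alpha>" "\<alpha> < \<beta>" "\<beta> \<le> b"
    and diff: "\<And>k x. k < m \<Longrightarrow> x \<in> {a..b} \<Longrightarrow> nth_deriv_on k {a..b} f differentiable (at x within {a..b})"
    and "k \<le> m" "x \<in> {\<alpha>..\<beta>}"
  shows "nth_deriv_on k {\<alpha>..\<beta>} f x = nth_deriv_on k {a..b} f x"
  using \<open>k \<le> m\<close> \<open>x \<in> {\<alpha>..\<beta>}\<close>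
proof (induction k arbitrary: x)
  case (Suc k)
  have x: "x \<in> {a..b}" using Suc.prems(2) assms(1,3) by auto
  have "(nth_deriv_on k {a..b} f has_vector_derivative nth_deriv_on (Suc k) {a..b} f x) (at x within {a..b})"
    using diff[of k x] x Suc.prems(1) by (simp add: vector_derivative_works[symmetric])
  then have "(nth_deriv_on k {a..b} f has_vector_derivative nth_deriv_on (Suc k) {a..b} f x) (at x within {\<alpha>..\<beta>})"
    by (rule has_vector_derivative_within_subset) (use assms(1,3) in auto)
  then have "(nth_deriv_on k {\<alpha>..\<beta>} f has_vector_derivative nth_deriv_on (Suc k) {a..b} f x) (at x within {\<alpha>..\<beta>})"
    by (rule has_vector_derivative_transform[OF Suc.prems(2), rotated]) (use Suc in simp)
  then have "vector_derivative (nth_deriv_on k {\<alpha>..\<beta>} f) (at x within {\<alpha>..\<beta>}) = nth_deriv_on (Suc k) {a..b} f x"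
    using vector_derivative_within_cbox[OF \<open>\<alpha> < \<beta>\<close>, of x] Suc.prems(2) by (simp add: box_real)
  then show ?case by simp
qed simp

lemma has_abs_cont_deriv_on_subinterval:
  assumes "a \<le> \<alpha>" "\<alpha> < \<beta>" "\<beta> \<le> b" and f: "has_abs_cont_deriv_on m {a..b} f"
  shows "has_abs_cont_deriv_on m {\<alpha>..\<beta>} f"
    and "k \<le> m \<Longrightarrow> x \<in> {\<alpha>..\<beta>} \<Longrightarrow> nth_deriv_on k {\<alpha>..\<beta>} f x = nth_deriv_on k {a..b} f x"
proof -
  have diff: "nth_deriv_on k {a..b} f differentiable (at x within {a..b})" if "k < m" "x \<in> {a..b}" for k x
    using f that unfolding has_abs_cont_deriv_on_def by blast
  have sub: "{\<alpha>..\<beta>} \<subseteq> {a..b}" using assms(1,3) by auto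
  show eq: "nth_deriv_on k {\<alpha>..\<beta>} f x = nth_deriv_on k {a..b} f x" if "k \<le> m" "x \<in> {\<alpha>..\<beta>}" for k x
    by (rule nth_deriv_on_subinterval[OF assms(1-3) diff that])
  show "has_abs_cont_deriv_on m {\<alpha>..\<beta>} f"
    unfolding has_abs_cont_deriv_on_def
  proof (intro conjI allI impI ballI)
    fix k x assume k: "k < m" and x: "x \<in> {\<alpha>..\<beta>}"
    have "nth_deriv_on k {a..b} f differentiable (at x within {\<alpha>..\<beta>})"
      using diff[OF k] x sub by (meson differentiable_within_subset subsetD)
    then show "nth_deriv_on k {\<alpha>..\<beta>} f differentiable (at x within {\<alpha>..\<beta>})"
      by (rule differentiable_transform_within[OF _ zero_less_one x]) (use eq k in simp)
  next
    show "absolutely_continuous_on {\<alpha>..\<beta>} (nth_deriv_on m {\<alpha>..\<beta>} f)"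
    proof (rule absolutely_continuous_on_cong[of _ "nth_deriv_on m {a..b} f"])
      show "absolutely_continuous_on {\<alpha>..\<beta>} (nth_deriv_on m {a..b} f)"
        using f sub unfolding has_abs_cont_deriv_on_def by (blast intro: absolutely_continuous_on_subset)
    qed (simp add: eq)
  qed
qed

text \<open>Downward induction from the top: once the next derivative is continuous, the current one
  is continuously differentiable.\<close>

lemma absolutely_continuous_on_nth_deriv_on:
  assumes f: "has_abs_cont_deriv_on m {a..b} f" and "k \<le> m"
  shows "absolutely_continuous_on {a..b} (nth_deriv_on k {a..b} f)"
  using \<open>k \<le> m\<close>
proof (induction k rule: inc_induct)
  case base
  show ?case using f by (simp add: has_abs_cont_deriv_on_def)
next
  case (step k)
  show ?case
  proof (rule C1_imp_absolutely_continuous_on)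
    show "continuous_on {a..b} (nth_deriv_on (Suc k) {a..b} f)"
      by (rule absolutely_continuous_on_imp_continuous_on[OF step.IH])
    fix x assume "x \<in> {a..b}"
    then show "(nth_deriv_on k {a..b} f has_vector_derivative nth_deriv_on (Suc k) {a..b} f x) (at x within {a..b})"
      using f step.hyps by (simp add: has_abs_cont_deriv_on_def vector_derivative_works[symmetric])
  qed
qed

section \<open>Endpoint values of the Bernoulli polynomials\<close>

text \<open>The reflected polynomial with its sign has the derivative and the vanishing integral
  that characterize \<open>bernpoly (Suc n)\<close>, so uniqueness identifies the two.\<close>

lemma bernpoly_reflect: "pcompose (bernpoly n) [:1, -1:] = smult ((-1) ^ n) (bernpoly n)"
proof (induction n)
  case (Suc n)
  let ?B = "bernpoly (Suc n)"
  let ?q = "smult ((-1) ^ Suc n) (pcompose ?B [:1, -1:])"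
  have "pderiv (pcompose ?B [:1, -1:]) = smult (- real (Suc n)) (pcompose (bernpoly n) [:1, -1:])"
    by (simp add: pderiv_pcompose pderiv_bernpoly_Suc pcompose_smult pderiv_pCons del: bernpoly.simps)
  then have "pderiv ?q = smult (real (Suc n)) (bernpoly n)"
    by (simp add: pderiv_smult pderiv_minus Suc.IH algebra_simps power_add[symmetric] del: bernpoly.simps)
      (simp add: add.commute flip: smult_minus_left)
  moreover have "integral {0..1} (poly ?q) = 0"
  proof -
    have "poly ?B integrable_on {0..1}"
      by (intro integrable_continuous_real continuous_intros)
    then have "(poly ?B has_integral 0) (cbox 0 1)"
      using integral_bernpoly_Suc[of n] by (metis box_real(2) integrable_integral)
    from has_integral_affinity[OF this, of "- 1" 1]
    have "((\<lambda>x. poly ?B (1 - x)) has_integral 0) ((\<lambda>x. 1 - x) ` {0..1})"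
      by (simp add: box_real)
    moreover have "(\<lambda>x::real. 1 - x) ` {0..1} = {0..1}"
      by (simp add: image_diff_atLeastAtMost)
    ultimately have "((\<lambda>x. (-1) ^ Suc n * poly ?B (1 - x)) has_integral (-1) ^ Suc n * 0) {0..1}"
      by (intro has_integral_mult_right) simp
    moreover have "poly ?q = (\<lambda>x. (-1) ^ Suc n * poly ?B (1 - x))"
      by (simp add: fun_eq_iff poly_pcompose)
    ultimately have "(poly ?q has_integral (-1) ^ Suc n * 0) {0..1}" by (simp only:)
    then show ?thesis by (metis integral_unique mult_zero_right)
  qed
  ultimately have "?q = ?B"
    using bernpoly_ex1[of "smult (real (Suc n)) (bernpoly n)"] pderiv_bernpoly_Suc integral_bernpoly_Suc by blast
  then have "smult ((-1) ^ Suc n) ?q = smult ((-1) ^ Suc n) ?B" by simp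
  then show ?case by (simp add: power_add[symmetric] del: bernpoly.simps)
qed (simp add: pcompose_1)

lemma bernpoly_1: "poly (bernpoly n) 1 = (-1) ^ n * bernoulli n"
  using arg_cong[OF bernpoly_reflect[of n], of "\<lambda>p. poly p 0"] by (simp add: poly_pcompose bernoulli_def)

text \<open>The difference of the endpoint values is \<open>n\<close> times the integral of the
  preceding polynomial, which vanishes because that polynomial has positive index.\<close>

lemma bernpoly_1_eq_bernoulli:
  assumes "2 \<le> n"
  shows "poly (bernpoly n) 1 = bernoulli n"
proof -
  obtain k where n: "n = Suc (Suc k)" using assms by (metis Suc_le_D numeral_2_eq_2 Suc_le_mono)
  have "((\<lambda>x. poly (pderiv (bernpoly n)) x) has_integral (poly (bernpoly n) 1 - poly (bernpoly n) 0)) {0..1}"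
    by (rule fundamental_theorem_of_calculus)
      (auto simp: has_real_derivative_iff_has_vector_derivative[symmetric] intro: poly_DERIV has_field_derivative_at_within)
  moreover have "poly (pderiv (bernpoly n)) = (\<lambda>x. real n * poly (bernpoly (Suc k)) x)"
    by (simp only: n pderiv_bernpoly_Suc poly_smult fun_eq_iff) simp
  ultimately have "poly (bernpoly n) 1 - poly (bernpoly n) 0 = real n * integral {0..1} (poly (bernpoly (Suc k)))"
    by (metis (no_types, lifting) integral_mult_right integral_unique ext)
  then show ?thesis by (simp only: integral_bernpoly_Suc bernoulli_def)
qed

text \<open>By reflection the monic linear polynomial takes opposite values at 0 and 1, which forces
  x - 1/2.\<close>

lemma bernoulli_1: "bernoulli 1 = - 1 / 2"
proof -
  obtain c where c: "bernpoly 1 = [:c, 1:]"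
  proof -
    have "degree (bernpoly 1) = 1" "coeff (bernpoly 1) 1 = 1"
      using degree_bernpoly[of 1] lead_coeff_bernpoly[of 1] by (simp_all del: One_nat_def)
    then show thesis
      using that[of "coeff (bernpoly 1) 0"]
      by (intro that) (rule poly_eqI, auto simp: coeff_pCons coeff_eq_0 split: nat.split)
  qed
  have "poly (bernpoly 1) 1 = - bernoulli 1" using bernpoly_1[of 1] by simp
  then show ?thesis using c by (simp add: bernoulli_def)
qed

section \<open>The quadrature formula on one interval\<close>

text \<open>Integrating the top derivative by parts lowers the degree of the kernel by one, since
  \<open>B\<^sub>n / n!\<close> is a primitive of \<open>B\<^sub>n\<^sub>-\<^sub>1 / (n - 1)!\<close>.\<close>

lemma quad_error_bernoulli_kernel_Suc:
  assumes "\<alpha> < \<beta>" and f: "has_abs_cont_deriv_on m {\<alpha>..\<beta>} f" and "n \<le> m"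
  defines "F \<equiv> nth_deriv_on n {\<alpha>..\<beta>} f" and "B \<equiv> bernpoly (Suc n)"
  shows "quad_error \<alpha> \<beta> (smult (1 / fact (Suc n)) B + [:c:]) f =
     (-1) ^ Suc n * (\<beta> - \<alpha>) ^ Suc n *
       ((poly B 1 / fact (Suc n) + c) * F \<beta> - (poly B 0 / fact (Suc n) + c) * F \<alpha>)
     + quad_error \<alpha> \<beta> (smult (1 / fact n) (bernpoly n)) f"
proof -
  let ?p = "smult (1 / fact (Suc n)) B + [:c:]" and ?q = "smult (1 / fact n) (bernpoly n)"
  define h where "h = \<beta> - \<alpha>"
  have deg: "degree ?p = Suc n" "degree ?q = n"
    using degree_bernoulli_kernel[of "Suc n" c] by (simp_all add: B_def degree_bernpoly)
  have p': "pderiv ?p = ?q"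
    by (simp add: B_def pderiv_add pderiv_smult pderiv_bernpoly_Suc pderiv_pCons del: bernpoly.simps of_nat_Suc)
  have "h * integral {0..1} (\<lambda>x. poly ?p x * nth_deriv_on (Suc n) {\<alpha>..\<beta>} f (\<alpha> + h * x))
      = poly ?p 1 * F \<beta> - poly ?p 0 * F \<alpha> - integral {0..1} (\<lambda>x. poly ?q x * F (\<alpha> + h * x))"
    using integral_poly_mult_deriv_unit[OF \<open>\<alpha> < \<beta>\<close> absolutely_continuous_on_nth_deriv_on[OF f \<open>n \<le> m\<close>], of ?p]
    unfolding p' h_def F_def by simp
  \<comment> \<open>Multiplying by these factors produces the normalization of
    \<open>quad_error\<close> for both kernels; the minus sign of the integration by parts turns
    \<open>(-1) ^ Suc n\<close> into \<open>(-1) ^ n\<close>.\<close>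
  then have "(-1) ^ Suc n * h ^ Suc n * (h * integral {0..1} (\<lambda>x. poly ?p x * nth_deriv_on (Suc n) {\<alpha>..\<beta>} f (\<alpha> + h * x)))
      = (-1) ^ Suc n * h ^ Suc n * (poly ?p 1 * F \<beta> - poly ?p 0 * F \<alpha>)
        + (-1) ^ n * h ^ Suc n * integral {0..1} (\<lambda>x. poly ?q x * F (\<alpha> + h * x))"
    by (simp add: right_diff_distrib)
  then show ?thesis
    unfolding quad_error_def deg by (simp add: h_def[symmetric] F_def mult.assoc mult.left_commute del: nth_deriv_on.simps)
qed

lemma integral_eq_quad_error_bernpoly:
  assumes "\<alpha> < \<beta>" and f: "has_abs_cont_deriv_on m {\<alpha>..\<beta>} f" and "n \<le> m"
  shows "integral {\<alpha>..\<beta>} f = (\<beta> - \<alpha>) / 2 * (f \<alpha> + f \<beta>)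
    + (\<Sum>k = 2..Suc n. bernoulli k / fact k * (\<beta> - \<alpha>) ^ k *
         (nth_deriv_on (k - 1) {\<alpha>..\<beta>} f \<alpha> - nth_deriv_on (k - 1) {\<alpha>..\<beta>} f \<beta>))
    + quad_error \<alpha> \<beta> (smult (1 / fact (Suc n)) (bernpoly (Suc n))) f"
  using \<open>n \<le> m\<close>
proof (induction n)
  \<comment> \<open>The kernel has index \<open>Suc n\<close>, so the base case already contains one
    integration by parts. It starts from the kernel 1, whose error term is the integral itself, and
    yields the trapezoidal rule.\<close>
  case 0
  have "f integrable_on {\<alpha>..\<beta>}"
    using absolutely_continuous_on_imp_continuous_on[OF absolutely_continuous_on_nth_deriv_on[OF f, of 0]]
    by (simp add: integrable_continuous_real)
  from has_integral_unit_interval[OF \<open>\<alpha> < \<beta>\<close> integrable_integral[OF this]]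
  have "integral {0..1} (\<lambda>x. f (\<alpha> + (\<beta> - \<alpha>) * x)) = integral {\<alpha>..\<beta>} f / (\<beta> - \<alpha>)"
    by (rule integral_unique)
  then have "quad_error \<alpha> \<beta> (smult (1 / fact 0) (bernpoly 0)) f = integral {\<alpha>..\<beta>} f"
    using \<open>\<alpha> < \<beta>\<close> by (simp add: quad_error_def)
  moreover have B: "poly (bernpoly (Suc 0)) 0 = - 1 / 2" "poly (bernpoly (Suc 0)) 1 = 1 / 2"
    using bernpoly_1[of 1] bernoulli_1 by (simp_all add: bernoulli_def)
  ultimately show ?case
    using quad_error_bernoulli_kernel_Suc[OF assms(1) f, of 0 0]
    by (simp add: B algebra_simps add_divide_distrib diff_divide_distrib del: bernpoly.simps)
next
  case (Suc n)
  have "poly (bernpoly (Suc (Suc n))) 1 = bernoulli (Suc (Suc n))"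
    "(-1) ^ Suc (Suc n) * bernoulli (Suc (Suc n)) = bernoulli (Suc (Suc n))"
    using bernpoly_1_eq_bernoulli[of "Suc (Suc n)"] bernpoly_1[of "Suc (Suc n)"] by simp_all
  note B = this
  let ?k = "Suc (Suc n)" and ?F = "nth_deriv_on (Suc n) {\<alpha>..\<beta>} f"
  have "quad_error \<alpha> \<beta> (smult (1 / fact ?k) (bernpoly ?k)) f =
     (-1) ^ ?k * (\<beta> - \<alpha>) ^ ?k * (bernoulli ?k / fact ?k * ?F \<beta> - bernoulli ?k / fact ?k * ?F \<alpha>)
     + quad_error \<alpha> \<beta> (smult (1 / fact (Suc n)) (bernpoly (Suc n))) f"
    using quad_error_bernoulli_kernel_Suc[OF assms(1) f Suc.prems, of 0] B(1)
    by (simp add: bernoulli_def[symmetric] del: bernpoly.simps power_Suc fact_Suc nth_deriv_on.simps)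
  also have "(-1) ^ ?k * (\<beta> - \<alpha>) ^ ?k * (bernoulli ?k / fact ?k * ?F \<beta> - bernoulli ?k / fact ?k * ?F \<alpha>)
      = ((-1) ^ ?k * bernoulli ?k) / fact ?k * (\<beta> - \<alpha>) ^ ?k * (?F \<beta> - ?F \<alpha>)"
    by (simp only: right_diff_distrib diff_divide_distrib times_divide_eq_left times_divide_eq_right mult_ac)
  finally have "quad_error \<alpha> \<beta> (smult (1 / fact (Suc n)) (bernpoly (Suc n))) f =
      bernoulli ?k / fact ?k * (\<beta> - \<alpha>) ^ ?k * (?F \<alpha> - ?F \<beta>)
      + quad_error \<alpha> \<beta> (smult (1 / fact ?k) (bernpoly ?k)) f"
    unfolding B(2) by (simp only: right_diff_distrib)
  moreover have "{2..Suc (Suc n)} = insert ?k {2..Suc n}" by auto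
  ultimately show ?case
    using Suc.IH Suc.prems by (simp del: bernpoly.simps power_Suc fact_Suc nth_deriv_on.simps)
qed

text \<open>Kernels that differ by a constant have the same derivative, so after one integration by
  parts their errors differ only in the boundary term.\<close>

lemma integral_eq_quad_error_kernel:
  assumes "\<alpha> < \<beta>" "1 \<le> n" and f: "has_abs_cont_deriv_on (n - 1) {\<alpha>..\<beta>} f"
  shows "integral {\<alpha>..\<beta>} f = (\<beta> - \<alpha>) / 2 * (f \<alpha> + f \<beta>)
    + (\<Sum>k = 2..n. bernoulli k / fact k * (\<beta> - \<alpha>) ^ k *
         (nth_deriv_on (k - 1) {\<alpha>..\<beta>} f \<alpha> - nth_deriv_on (k - 1) {\<alpha>..\<beta>} f \<beta>))
    + (-1) ^ n * c * (\<beta> - \<alpha>) ^ n * (nth_deriv_on (n - 1) {\<alpha>..\<beta>} f \<alpha> - nth_deriv_on (n - 1) {\<alpha>..\<beta>} f \<beta>)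
    + quad_error \<alpha> \<beta> (smult (1 / fact n) (bernpoly n) + [:c:]) f"
proof -
  obtain m where n: "n = Suc m" using \<open>1 \<le> n\<close> by (cases n) auto
  have f': "has_abs_cont_deriv_on m {\<alpha>..\<beta>} f" using f n by simp
  let ?F = "nth_deriv_on m {\<alpha>..\<beta>} f"
  have "quad_error \<alpha> \<beta> (smult (1 / fact n) (bernpoly n) + [:c:]) f
      = quad_error \<alpha> \<beta> (smult (1 / fact n) (bernpoly n) + [:0:]) f + (-1) ^ n * c * (\<beta> - \<alpha>) ^ n * (?F \<beta> - ?F \<alpha>)"
    \<comment> \<open>Written with \<open>[:0:]\<close>, the kernel without constant is an instance
      of the same equation, which thus expands both sides.\<close>
    unfolding n quad_error_bernoulli_kernel_Suc[OF assms(1) f' order_refl] by (simp only: algebra_simps add_0)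
  with integral_eq_quad_error_bernpoly[OF assms(1) f' order_refl] show ?thesis
    unfolding n by (simp add: right_diff_distrib del: bernpoly.simps power_Suc fact_Suc nth_deriv_on.simps)
qed

section \<open>The composite formula\<close>

theorem corollary3p2:
  fixes n N :: nat and a b c h :: real and f :: "real \<Rightarrow> real"
  assumes "n \<ge> 1" and "N \<ge> 1" and "a < b"
    and "h = (b - a) / real N"
    and "has_abs_cont_deriv_on (n - 1) {a..b} f"
  shows "integral {a..b} f =
      (b - a) / (2 * real N) * (f a + f b)
    + (b - a) / real N * (\<Sum>k = 1..N - 1. f (a + real k * h))
    + (\<Sum>k = 2..n. bernoulli k / fact k * ((b - a) / real N) ^ k *
         (nth_deriv_on (k - 1) {a..b} f a - nth_deriv_on (k - 1) {a..b} f b))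
    + (-1) ^ n * c * ((b - a) / real N) ^ n *
         (nth_deriv_on (n - 1) {a..b} f a - nth_deriv_on (n - 1) {a..b} f b)
    + composite_quad_error N a b (smult (1 / fact n) (bernpoly n) + [:c:]) f"
proof -
  define x where "x k = a + real k * h" for k
  have "0 < h" and x0: "x 0 = a" and xN: "x N = b"
    using assms(2-4) by (simp_all add: x_def)
  have step: "x (Suc k) - x k = h" for k by (simp add: x_def algebra_simps)
  have lt: "x k < x (Suc k)" for k using step[of k] \<open>0 < h\<close> by linarith
  have ax: "a \<le> x k" for k using \<open>0 < h\<close> by (simp add: x_def)
  have xb: "x k \<le> b" if "k \<le> N" for k
    using that \<open>0 < h\<close> by (simp add: x_def flip: xN)
  let ?G = "\<lambda>j y. nth_deriv_on j {a..b} f y"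
  let ?p = "smult (1 / fact n) (bernpoly n) + [:c:]"
  have piece: "integral {x k..x (Suc k)} f = h / 2 * (f (x k) + f (x (Suc k)))
      + (\<Sum>j = 2..n. bernoulli j / fact j * h ^ j * (?G (j - 1) (x k) - ?G (j - 1) (x (Suc k))))
      + (-1) ^ n * c * h ^ n * (?G (n - 1) (x k) - ?G (n - 1) (x (Suc k)))
      + quad_error (x k) (x (Suc k)) ?p f" if "k < N" for k
  proof -
    have "x (Suc k) \<le> b" using that by (intro xb) simp
    note sub = has_abs_cont_deriv_on_subinterval[OF ax lt this assms(5)]
    \<comment> \<open>Outside the error term only orders up to \<open>n - 1\<close> occur, so the
      derivatives within the subinterval may be replaced by those within \<open>{a..b}\<close>;
      adjacent pieces then share their values at the common node.\<close>
    have eq: "nth_deriv_on j {x k..x (Suc k)} f (x k) = ?G j (x k)"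
      "nth_deriv_on j {x k..x (Suc k)} f (x (Suc k)) = ?G j (x (Suc k))" if "j \<le> n - 1" for j
      using sub(2)[OF that] lt[of k] by (simp_all add: less_imp_le)
    have "(\<Sum>j = 2..n. bernoulli j / fact j * h ^ j * (nth_deriv_on (j - 1) {x k..x (Suc k)} f (x k)
          - nth_deriv_on (j - 1) {x k..x (Suc k)} f (x (Suc k))))
        = (\<Sum>j = 2..n. bernoulli j / fact j * h ^ j * (?G (j - 1) (x k) - ?G (j - 1) (x (Suc k))))"
    proof (intro sum.cong refl)
      fix j assume "j \<in> {2..n}"
      then have "j - 1 \<le> n - 1" by auto
      then show "bernoulli j / fact j * h ^ j * (nth_deriv_on (j - 1) {x k..x (Suc k)} f (x k)
          - nth_deriv_on (j - 1) {x k..x (Suc k)} f (x (Suc k)))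
        = bernoulli j / fact j * h ^ j * (?G (j - 1) (x k) - ?G (j - 1) (x (Suc k)))"
        by (simp only: eq)
    qed
    then show ?thesis
      using integral_eq_quad_error_kernel[OF lt assms(1) sub(1), of c] by (simp only: step eq order_refl)
  qed
  have tele: "(\<Sum>k<N. ?G j (x k) - ?G j (x (Suc k))) = ?G j a - ?G j b" for j
    using sum_lessThan_telescope'[of "\<lambda>k. ?G j (x k)" N] by (simp add: x0 xN)
  have "continuous_on {a..b} f"
    using absolutely_continuous_on_imp_continuous_on[OF absolutely_continuous_on_nth_deriv_on[OF assms(5), of 0]] by simp
  then have fint: "f integrable_on {x i..x j}" if "j \<le> N" for i j
  proof -
    have "{x i..x j} \<subseteq> {a..b}" using ax[of i] xb[OF that] by auto
    then show ?thesis by (intro integrable_continuous_real continuous_on_subset[OF \<open>continuous_on {a..b} f\<close>])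
  qed
  have "integral {a..x m} f = (\<Sum>k<m. integral {x k..x (Suc k)} f)" if "m \<le> N" for m
    using that
  proof (induction m)
    case (Suc m)
    have "integral {a..x m} f + integral {x m..x (Suc m)} f = integral {a..x (Suc m)} f"
      using fint[OF Suc.prems, of 0] lt[of m] by (intro Henstock_Kurzweil_Integration.integral_combine ax) (auto simp: x0 less_imp_le)
    then show ?case using Suc by simp
  qed (simp add: x0)
  from this[OF order_refl] have "integral {a..b} f = (\<Sum>k<N. integral {x k..x (Suc k)} f)"
    by (simp add: xN)
  also have "\<dots> = (\<Sum>k<N. h / 2 * (f (x k) + f (x (Suc k)))
      + (\<Sum>j = 2..n. bernoulli j / fact j * h ^ j * (?G (j - 1) (x k) - ?G (j - 1) (x (Suc k))))
      + (-1) ^ n * c * h ^ n * (?G (n - 1) (x k) - ?G (n - 1) (x (Suc k)))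
      + quad_error (x k) (x (Suc k)) ?p f)"
    by (rule sum.cong) (use piece in auto)
  also have "\<dots> = (\<Sum>k<N. h / 2 * (f (x k) + f (x (Suc k))))
      + (\<Sum>j = 2..n. bernoulli j / fact j * h ^ j * (\<Sum>k<N. ?G (j - 1) (x k) - ?G (j - 1) (x (Suc k))))
      + (-1) ^ n * c * h ^ n * (\<Sum>k<N. ?G (n - 1) (x k) - ?G (n - 1) (x (Suc k)))
      + (\<Sum>k<N. quad_error (x k) (x (Suc k)) ?p f)"
    \<comment> \<open>Exchanging the two sums brings the sum over the subintervals inside, where it
      telescopes for each order of derivative.\<close>
    unfolding sum.distrib sum.swap[of _ "{2..n}" "{..<N}"] by (simp only: sum_distrib_left)
  also have "\<dots> = (\<Sum>k<N. h / 2 * (f (x k) + f (x (Suc k))))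
      + (\<Sum>j = 2..n. bernoulli j / fact j * h ^ j * (?G (j - 1) a - ?G (j - 1) b))
      + (-1) ^ n * c * h ^ n * (?G (n - 1) a - ?G (n - 1) b)
      + (\<Sum>k<N. quad_error (x k) (x (Suc k)) ?p f)"
    by (simp only: tele)
  also have "(\<Sum>k<N. quad_error (x k) (x (Suc k)) ?p f) = composite_quad_error N a b ?p f"
    by (simp add: composite_quad_error_def Let_def x_def assms(4) del: of_nat_Suc)
  also have "(\<Sum>k<N. h / 2 * (f (x k) + f (x (Suc k)))) = h / 2 * (f a + f b) + h * (\<Sum>k = 1..N - 1. f (x k))"
  proof -
    \<comment> \<open>With \<open>N = Suc M\<close>, left ends contribute \<open>a\<close> and the
      inner nodes, right ends the inner nodes and \<open>b\<close>; so inner nodes count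
      twice.\<close>
    obtain M where N: "N = Suc M" using assms(2) by (cases N) auto
    have "(\<Sum>k<N. f (x k)) = f a + (\<Sum>k<M. f (x (Suc k)))"
      unfolding N by (simp add: sum.lessThan_Suc_shift x0 del: sum.lessThan_Suc)
    moreover have "(\<Sum>k<N. f (x (Suc k))) = (\<Sum>k<M. f (x (Suc k))) + f b"
      using xN unfolding N by simp
    moreover have "(\<Sum>k<M. f (x (Suc k))) = (\<Sum>k = 1..N - 1. f (x k))"
      unfolding N by (simp add: sum.atLeast1_atMost_eq)
    ultimately have "(\<Sum>k<N. f (x k) + f (x (Suc k))) = f a + f b + 2 * (\<Sum>k = 1..N - 1. f (x k))"
      by (simp add: sum.distrib)
    then show ?thesis
      by (simp only: sum_distrib_left[symmetric]) (simp add: algebra_simps)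
  qed
  finally show ?thesis
    by (simp add: x_def assms(4))
qed

end
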